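(* Let $(X,d)$ be a metric space, let $f_n:X\to X$, $n\ge0$, be maps, let $A=(a_{ij})_{N\times N}$ be a transition matrix, and let $V_i$, $1\le i\le N$, be nonempty bounded subsets of $X$ with $d(V_i,V_j)>0$ for all $1\le i\neq j\le N$. Assume that there exist nonempty compact subsets $V_{i,n}$ of $X$ with $V_{i,n}\subset V_i$, $1\le i\le N$, $n\ge0$, such that $\{f_n\}_{n=0}^\infty$ is equi-continuous in $E:=\bigcup_{n=0}^{\infty}\bigcup_{i=1}^{N}V_{i,n}$ and the system $x_{n+1}=f_n(x_n)$ is weakly $A$-coupled-expanding in $\{V_{i,n}\}_{n=0}^\infty$, $1\le i\le N$. Assume further that there exists $\lambda>1$ such that $d(f_n(x),f_n(y))\ge\lambda d(x,y)$ for all $x,y\in V_{i,n}$, $1\le i\le N$, $n\ge0$. Then for every $n\ge0$ there exists a nonempty compact subset $\Lambda_n\subset\bigcup_{i=1}^N V_{i,n}$ with $f_n(\Lambda_n)=\Lambda_{n+1}$ such that the invariant subsystem of $x_{n+1}=f_n(x_n)$ on $\{\Lambda_n\}_{n=0}^\infty$ is topologically equi-conjugate to $(\Sigma_N^+(A),\sigma_A)$. Consequently, if $(X,d)$ is compact, then $h(f_{0,\infty},\Lambda_0)=\log\rho(A)$. Further, if $A$ is irreducible and $\sum_{j=1}^N a_{i_0j}\ge2$ for some $1\le i_0\le N$, then the system $x_{n+1}=f_n(x_n)$ is Li-Yorke $\delta$-chaotic for some $\delta>0$, is chaotic in the strong sense of Li-Yorke, and is also distributionally chaotic.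
   Context: $f_{0,\infty}:=\{f_n\}_{n=0}^\infty$. Notation: $f_i^n:=f_{i+n-1}\circ\cdots\circ f_i$ for $n\ge1$, $f_i^0$ is the identity, and $f_i^{-n}:=(f_i^n)^{-1}$ (preimage). $d(B,C):=\inf\{d(b,c):b\in B,c\in C\}$; $\partial B$ is the boundary of $B$. A sequence of maps $h_n:\Lambda_n\to Y$ into a metric space $(Y,e)$ is equi-continuous in $\{\Lambda_n\}_{n=0}^\infty$ if for every $\epsilon>0$ there is $\delta>0$ such that $e(h_n(x),h_n(y))<\epsilon$ for all $n\ge0$ and all $x,y\in\Lambda_n$ at distance less than $\delta$; "equi-continuous in $E$" means this with $\Lambda_n=E$ for all $n$. A transition matrix is a matrix $A=(a_{ij})_{N\times N}$, $N\ge2$, with $a_{ij}\in\{0,1\}$, $\sum_{j=1}^N a_{ij}\ge1$ for all $i$ and $\sum_{i=1}^N a_{ij}\ge1$ for all $j$; it is irreducible if for each pair $1\le i,j\le N$ there is $k\ge1$ such that the $(i,j)$ entry of $A^k$ is positive. The system $x_{n+1}=f_n(x_n)$ is weakly $A$-coupled-expanding in sequences $\{V_{i,n}\}_{n=0}^\infty$, $1\le i\le N$, of nonempty subsets of $X$ if $V_{i,n}\cap V_{j,n}=\partial V_{i,n}\cap\partial V_{j,n}$ for all $1\le i\ne j\le N$, $n\ge0$, and $f_n(V_{i,n})\supset\bigcup_{j:\,a_{ij}=1}V_{j,n+1}$ for all $1\le i\le N$, $n\ge0$. $\Sigma_N^+(A):=\{s=(s_0,s_1,\dots):1\le s_j\le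 N,\ a_{s_js_{j+1}}=1,\ j\ge0\}$, with metric $\hat\rho(\alpha,\beta):=\sum_{i=0}^\infty \hat d(a_i,b_i)/2^i$ for $\alpha=(a_0,a_1,\dots)$, $\beta=(b_0,b_1,\dots)$, where $\hat d(a,b)=0$ if $a=b$ and $1$ otherwise. $\sigma_A:\Sigma_N^+(A)\to\Sigma_N^+(A)$, $\sigma_A((s_0,s_1,s_2,\dots)):=(s_1,s_2,\dots)$. $\rho(A):=\lim_{n\to\infty}\|A^n\|^{1/n}$, where $\|B\|$ denotes the sum of all entries of $B$. For subsets $\Lambda_n\subset X$ with $f_n(\Lambda_n)\subset\Lambda_{n+1}$ for all $n\ge0$, the system restricted to $\{\Lambda_n\}$ is called the invariant subsystem on $\{\Lambda_n\}_{n=0}^\infty$. It is topologically equi-conjugate to $(\Sigma_N^+(A),\sigma_A)$ if there are bijections $h_n:\Lambda_n\to\Sigma_N^+(A)$, $n\ge0$, with $h_{n+1}\circ f_n=\sigma_A\circ h_n$ on $\Lambda_n$ for all $n\ge0$, such that $\{h_n\}$ is equi-continuous in $\{\Lambda_n\}$ and $\{h_n^{-1}\}$ is equi-continuous in $\Sigma_N^+(A)$. Topological entropy: for compact $X$ and nonempty $Y\subset X$, $h(f_{0,\infty},Y):=\sup_{\mathcal A}\limsup_{n\to\infty}\frac1n\log\mathcal N(\mathcal A_0^n|_Y)$, the supremum over open covers $\mathcal A$ of $X$, where $\mathcal A_0^n:=\{\bigcap_{j=0}^{n-1}f_0^{-j}(A_j):A_j\in\mathcal A\}$, $\mathcal B|_Y:=\{B\cap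 Y:B\in\mathcal B\}$, and $\mathcal N(\cdot)$ is the minimal cardinality of a subcover. Chaos: the system is Li-Yorke $\delta$-chaotic ($\delta>0$) if there is an uncountable set $S\subset X$ (Li-Yorke $\delta$-scrambled set) such that for any distinct $x,y\in S$, $\liminf_{n\to\infty}d(f_0^n(x),f_0^n(y))=0$ and $\limsup_{n\to\infty}d(f_0^n(x),f_0^n(y))>\delta$; it is chaotic in the strong sense of Li-Yorke if, for some $\delta>0$, there is such an $S$ for which moreover all orbits $\{f_0^n(x)\}_{n\ge0}$, $x\in S$, are bounded. It is distributionally chaotic if there is an uncountable set $D\subset X$ such that for any distinct $x,y\in D$: (i) $\limsup_{n\to\infty}\frac1n\sum_{i=0}^{n-1}\chi_{[0,\epsilon)}(d(f_0^i(x),f_0^i(y)))=1$ for every $\epsilon>0$, and (ii) $\liminf_{n\to\infty}\frac1n\sum_{i=0}^{n-1}\chi_{[0,\delta)}(d(f_0^i(x),f_0^i(y)))=0$ for some $\delta>0$, where $\chi$ is the characteristic function. *)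

theory Defs
  imports "HOL-Analysis.Analysis"
begin

text \<open>
  The metric space $X$ is the universe of a type of class \<open>metric_space\<close>, and the index set
  $1, \ldots, N$ is a finite type \<open>'n\<close> with $N$ elements.
\<close>

text \<open>\<open>orbit_map f i n\<close> is $f_i^n = f_{i+n-1} \circ \cdots \circ f_i$.\<close>

primrec orbit_map :: "(nat \<Rightarrow> 'a \<Rightarrow> 'a) \<Rightarrow> nat \<Rightarrow> nat \<Rightarrow> 'a \<Rightarrow> 'a" where
  "orbit_map f i 0 = id"
| "orbit_map f i (Suc n) = f (i + n) \<circ> orbit_map f i n"

text \<open>The metrics are explicit arguments because the metric of the shift space below is not
  the one the library puts on the function type.\<close>

definition equi_continuous_in ::
  "('a \<Rightarrow> 'a \<Rightarrow> real) \<Rightarrow> ('b \<Rightarrow> 'b \<Rightarrow> real) \<Rightarrow> (nat \<Rightarrow> 'a set) \<Rightarrow> (nat \<Rightarrow> 'a \<Rightarrow> 'b) \<Rightarrow> bool" where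
  "equi_continuous_in d e L h \<longleftrightarrow>
     (\<forall>\<epsilon>>0. \<exists>\<delta>>0. \<forall>n. \<forall>x\<in>L n. \<forall>y\<in>L n. d x y < \<delta> \<longrightarrow> e (h n x) (h n y) < \<epsilon>)"

definition transition_matrix :: "real^'n^'n \<Rightarrow> bool" where
  "transition_matrix A \<longleftrightarrow>
     CARD('n) \<ge> 2 \<and>
     (\<forall>i j. A $ i $ j \<in> {0, 1}) \<and>
     (\<forall>i. (\<Sum>j\<in>UNIV. A $ i $ j) \<ge> 1) \<and>
     (\<forall>j. (\<Sum>i\<in>UNIV. A $ i $ j) \<ge> 1)"

text \<open>The power operation of the library is unrelated to the matrix product on this type.\<close>

primrec matrix_pow :: "real^'n^'n \<Rightarrow> nat \<Rightarrow> real^'n^'n" where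
  "matrix_pow A 0 = mat 1"
| "matrix_pow A (Suc k) = A ** matrix_pow A k"

definition irreducible_matrix :: "real^'n^'n \<Rightarrow> bool" where
  "irreducible_matrix A \<longleftrightarrow> (\<forall>i j. \<exists>k\<ge>1. matrix_pow A k $ i $ j > 0)"

definition entry_sum :: "real^'n^'n \<Rightarrow> real" where
  "entry_sum B = (\<Sum>i\<in>UNIV. \<Sum>j\<in>UNIV. B $ i $ j)"

definition growth_rate :: "real^'n^'n \<Rightarrow> real" where
  "growth_rate A = lim (\<lambda>n. root n (entry_sum (matrix_pow A n)))"

definition shift_space :: "real^'n^'n \<Rightarrow> (nat \<Rightarrow> 'n) set" where
  "shift_space A = {s. \<forall>j. A $ s j $ s (Suc j) = 1}"

definition shift_dist :: "(nat \<Rightarrow> 'n) \<Rightarrow> (nat \<Rightarrow> 'n) \<Rightarrow> real" where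
  "shift_dist \<alpha> \<beta> = (\<Sum>i. (if \<alpha> i = \<beta> i then 0 else 1) / 2 ^ i)"

definition shift :: "(nat \<Rightarrow> 'n) \<Rightarrow> nat \<Rightarrow> 'n" where
  "shift s = (\<lambda>j. s (Suc j))"

definition weakly_coupled_expanding ::
  "real^'n^'n \<Rightarrow> (nat \<Rightarrow> 'a::metric_space \<Rightarrow> 'a) \<Rightarrow> ('n \<Rightarrow> nat \<Rightarrow> 'a set) \<Rightarrow> bool" where
  "weakly_coupled_expanding A f V \<longleftrightarrow>
     (\<forall>i n. V i n \<noteq> {}) \<and>
     (\<forall>i j n. i \<noteq> j \<longrightarrow> V i n \<inter> V j n = frontier (V i n) \<inter> frontier (V j n)) \<and>
     (\<forall>i n. (\<Union>j\<in>{j. A $ i $ j = 1}. V j (Suc n)) \<subseteq> f n ` V i n)"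

definition equi_conjugate_to_shift ::
  "(nat \<Rightarrow> 'a::metric_space \<Rightarrow> 'a) \<Rightarrow> (nat \<Rightarrow> 'a set) \<Rightarrow> real^'n^'n \<Rightarrow> bool" where
  "equi_conjugate_to_shift f L A \<longleftrightarrow>
     (\<forall>n. f n ` L n \<subseteq> L (Suc n)) \<and>
     (\<exists>h :: nat \<Rightarrow> 'a \<Rightarrow> nat \<Rightarrow> 'n.
        (\<forall>n. bij_betw (h n) (L n) (shift_space A)) \<and>
        (\<forall>n. \<forall>x\<in>L n. h (Suc n) (f n x) = shift (h n x)) \<and>
        equi_continuous_in dist shift_dist L h \<and>
        equi_continuous_in shift_dist dist (\<lambda>n. shift_space A) (\<lambda>n. inv_into (L n) (h n)))"

definition open_cover :: "'a::topological_space set set \<Rightarrow> bool" where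
  "open_cover \<A> \<longleftrightarrow> (\<forall>U\<in>\<A>. open U) \<and> \<Union>\<A> = UNIV"

definition refined_cover ::
  "(nat \<Rightarrow> 'a \<Rightarrow> 'a) \<Rightarrow> 'a set set \<Rightarrow> nat \<Rightarrow> 'a set set" where
  "refined_cover f \<A> n =
     {\<Inter>j\<in>{..<n}. orbit_map f 0 j -` U j | U. \<forall>j<n. U j \<in> \<A>}"

definition restricted_cover :: "'a set set \<Rightarrow> 'a set \<Rightarrow> 'a set set" where
  "restricted_cover \<B> Y = (\<lambda>B. B \<inter> Y) ` \<B>"

text \<open>
  Minimal cardinality of a subcover of the cover \<open>\<C>\<close> of \<open>Y\<close>. In a compact space the refined covers
  of open covers have finite subcovers even if the maps are not continuous (take preimages of a
  finite subcover of the original cover), so the infimum is not over the empty set.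
\<close>

definition cover_number :: "'a set set \<Rightarrow> 'a set \<Rightarrow> nat" where
  "cover_number \<C> Y = Inf {card \<F> | \<F>. \<F> \<subseteq> \<C> \<and> finite \<F> \<and> \<Union>\<F> = Y}"

definition topological_entropy ::
  "(nat \<Rightarrow> 'a::topological_space \<Rightarrow> 'a) \<Rightarrow> 'a set \<Rightarrow> ereal" where
  "topological_entropy f Y =
     (SUP \<A>\<in>{\<A>. open_cover \<A>}.
        limsup (\<lambda>n. ereal (1 / real n *
          ln (real (cover_number (restricted_cover (refined_cover f \<A> n) Y) Y)))))"

text \<open>The limits are taken in the extended reals since distances along orbits may be unbounded.\<close>

definition li_yorke_scrambled ::
  "(nat \<Rightarrow> 'a::metric_space \<Rightarrow> 'a) \<Rightarrow> real \<Rightarrow> 'a set \<Rightarrow> bool" where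
  "li_yorke_scrambled f \<delta> S \<longleftrightarrow>
     uncountable S \<and>
     (\<forall>x\<in>S. \<forall>y\<in>S. x \<noteq> y \<longrightarrow>
        liminf (\<lambda>n. ereal (dist (orbit_map f 0 n x) (orbit_map f 0 n y))) = 0 \<and>
        limsup (\<lambda>n. ereal (dist (orbit_map f 0 n x) (orbit_map f 0 n y))) > ereal \<delta>)"

definition li_yorke_chaotic :: "(nat \<Rightarrow> 'a::metric_space \<Rightarrow> 'a) \<Rightarrow> real \<Rightarrow> bool" where
  "li_yorke_chaotic f \<delta> \<longleftrightarrow> \<delta> > 0 \<and> (\<exists>S. li_yorke_scrambled f \<delta> S)"

definition strongly_li_yorke_chaotic :: "(nat \<Rightarrow> 'a::metric_space \<Rightarrow> 'a) \<Rightarrow> bool" where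
  "strongly_li_yorke_chaotic f \<longleftrightarrow>
     (\<exists>\<delta>>0. \<exists>S. li_yorke_scrambled f \<delta> S \<and>
        (\<forall>x\<in>S. bounded (range (\<lambda>n. orbit_map f 0 n x))))"

definition proximity_frequency ::
  "(nat \<Rightarrow> 'a::metric_space \<Rightarrow> 'a) \<Rightarrow> real \<Rightarrow> 'a \<Rightarrow> 'a \<Rightarrow> nat \<Rightarrow> real" where
  "proximity_frequency f \<epsilon> x y n =
     1 / real n * (\<Sum>i<n. indicator {0..<\<epsilon>} (dist (orbit_map f 0 i x) (orbit_map f 0 i y)))"

definition distributionally_chaotic :: "(nat \<Rightarrow> 'a::metric_space \<Rightarrow> 'a) \<Rightarrow> bool" where
  "distributionally_chaotic f \<longleftrightarrow>
     (\<exists>D. uncountable D \<and>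
        (\<forall>x\<in>D. \<forall>y\<in>D. x \<noteq> y \<longrightarrow>
           (\<forall>\<epsilon>>0. limsup (\<lambda>n. ereal (proximity_frequency f \<epsilon> x y n)) = 1) \<and>
           (\<exists>\<delta>>0. liminf (\<lambda>n. ereal (proximity_frequency f \<delta> x y n)) = 0)))"

end

theory Submission
  imports Defs
begin

text \<open>
  Expansion makes a point of \<open>W\<close> determined by its itinerary through the sets \<open>W i n\<close>, and covering
  realises every admissible itinerary, so at each time \<open>n\<close> the shift space is coded into \<open>X\<close>; the images
  are the sets \<open>\<Lambda>\<^sub>n\<close>. Points whose itineraries agree for a long time are close, uniformly in \<open>n\<close>, by
  expansion. Conversely, close points have itineraries agreeing for a long time, because equi-continuity
  keeps their orbits close while different symbols are a fixed distance apart. For the entropy,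
  the words of length \<open>n + 1\<close> are counted by the entries of \<open>A\<^sup>n\<close>, whose growth rate exists by
  Fekete's lemma. For chaos, concatenate two distinct loops \<open>u\<close>, \<open>v\<close> of equal length at one vertex,
  choosing between them according to binary codes which, on time blocks growing factorially, agree
  entirely or differ everywhere.
\<close>

section \<open>Orbits and the metric of the shift space\<close>

lemma orbit_map_Suc_right: "orbit_map f n (Suc k) x = orbit_map f (Suc n) k (f n x)"
  by (induction k) auto

lemma summable_shift_dist:
  "summable (\<lambda>i. (if \<alpha> i = \<beta> i then 0 else 1) / 2 ^ i :: real)"
proof (rule summable_comparison_test')
  show "summable (\<lambda>i. (1/2) ^ i :: real)" by (rule summable_geometric) simp
qed (auto simp: power_one_over)

text \<open>The first \<open>K\<close> terms vanish and the others are dominated by a geometric tail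
  of sum \<open>2 / 2 ^ K\<close>.\<close>

lemma shift_dist_le:
  assumes "\<And>j. j < K \<Longrightarrow> \<alpha> j = \<beta> j"
  shows "shift_dist \<alpha> \<beta> \<le> 2 / 2 ^ K"
proof -
  let ?g = "\<lambda>i. (if \<alpha> i = \<beta> i then 0 else 1) / 2 ^ i :: real"
  have "shift_dist \<alpha> \<beta> = (\<Sum>i. ?g (i + K)) + (\<Sum>i<K. ?g i)"
    unfolding shift_dist_def by (rule suminf_split_initial_segment[OF summable_shift_dist])
  also have "(\<Sum>i<K. ?g i) = 0" using assms by (intro sum.neutral) auto
  also have "(\<Sum>i. ?g (i + K)) \<le> (\<Sum>i. (1/2) ^ K * (1/2) ^ i)"
  proof (rule suminf_le)
    show "summable (\<lambda>i. ?g (i + K))"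
      by (rule summable_ignore_initial_segment[OF summable_shift_dist])
    show "summable (\<lambda>i. (1/2) ^ K * (1/2) ^ i :: real)"
      by (intro summable_mult summable_geometric) auto
  qed (auto simp: power_one_over power_add field_simps)
  also have "\<dots> = 2 / 2 ^ K"
    by (subst suminf_mult) (auto simp: suminf_geometric power_one_over summable_geometric)
  finally show ?thesis by simp
qed

text \<open>A disagreement at index \<open>j\<close> alone contributes \<open>1 / 2 ^ j\<close>,
  which is at least \<open>1 / 2 ^ K\<close>.\<close>

lemma shift_dist_less_imp_eq:
  assumes "shift_dist \<alpha> \<beta> < 1 / 2 ^ K" "j \<le> K"
  shows "\<alpha> j = \<beta> j"
proof (rule ccontr)
  let ?g = "\<lambda>i. (if \<alpha> i = \<beta> i then 0 else 1) / 2 ^ i :: real"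
  assume ne: "\<alpha> j \<noteq> \<beta> j"
  have "(1::real) / 2 ^ K \<le> 1 / 2 ^ j"
    using assms(2) by (simp add: field_simps)
  also have "\<dots> = sum ?g {j}" using ne by simp
  also have "\<dots> \<le> shift_dist \<alpha> \<beta>"
    unfolding shift_dist_def by (rule sum_le_suminf[OF summable_shift_dist]) auto
  finally show False using assms(1) by simp
qed

lemma inverse_power_less_ex:
  assumes "(c::real) > 1" "\<epsilon> > 0"
  obtains K where "D / c ^ K < \<epsilon>"
proof -
  have "(\<lambda>K. D / c ^ K) \<longlonglongrightarrow> 0"
    using assms(1) by (rule LIMSEQ_divide_realpow_zero)
  then have "\<forall>\<^sub>F K in sequentially. D / c ^ K < \<epsilon>"
    using assms(2) by (rule order_tendstoD)
  then show ?thesis using that by (auto simp: eventually_sequentially)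
qed

text \<open>Reduces equi-continuity into the shift space to agreement of finitely many symbols,
  since \<open>K\<close> common symbols force distance at most \<open>2 / 2 ^ K\<close>.\<close>

lemma equi_continuous_in_shift_dist:
  assumes "\<And>K. \<exists>\<delta>>0. \<forall>n. \<forall>x\<in>L n. \<forall>y\<in>L n. d x y < \<delta> \<longrightarrow> (\<forall>j<K. h n x j = h n y j)"
  shows "equi_continuous_in d shift_dist L h"
  unfolding equi_continuous_in_def
proof (intro allI impI)
  fix \<epsilon> :: real assume "\<epsilon> > 0"
  then obtain K where K: "2 / 2 ^ K < \<epsilon>"
    using inverse_power_less_ex[of 2 \<epsilon> 2] by auto
  obtain \<delta> where "\<delta> > 0"
    and "\<forall>n. \<forall>x\<in>L n. \<forall>y\<in>L n. d x y < \<delta> \<longrightarrow> (\<forall>j<K. h n x j = h n y j)"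
    using assms[of K] by blast
  then show "\<exists>\<delta>>0. \<forall>n. \<forall>x\<in>L n. \<forall>y\<in>L n. d x y < \<delta> \<longrightarrow> shift_dist (h n x) (h n y) < \<epsilon>"
    using K by (meson order.strict_trans1 shift_dist_le)
qed

text \<open>Runs of \<open>P\<close> that are arbitrarily long compared with the time preceding them.\<close>

definition long_runs :: "(nat \<Rightarrow> bool) \<Rightarrow> bool" where
  "long_runs P \<longleftrightarrow> (\<forall>M. \<exists>a b. M \<le> a \<and> M * (a + 1) \<le> b \<and> (\<forall>i. a \<le> i \<longrightarrow> i < b \<longrightarrow> P i))"

lemma long_runs_mono: "long_runs P \<Longrightarrow> (\<And>i. P i \<Longrightarrow> Q i) \<Longrightarrow> long_runs Q"
  unfolding long_runs_def by meson

lemma long_runs_frequently: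
  assumes "long_runs P"
  shows "\<exists>\<^sub>F i in sequentially. P i"
  unfolding frequently_sequentially
proof
  fix N
  obtain a b where "Suc (Suc N) \<le> a" "Suc (Suc N) * (a + 1) \<le> b" "\<forall>i. a \<le> i \<longrightarrow> i < b \<longrightarrow> P i"
    using assms unfolding long_runs_def by blast
  then show "\<exists>n\<ge>N. P n" by (intro exI[of _ a]) auto
qed

text \<open>At the end \<open>b\<close> of a run only the times before \<open>a\<close> can fail,
  and they are a fraction \<open>a / b\<close> of all times, which the length of the run makes
  small.\<close>

lemma long_runs_frequency:
  assumes "long_runs P" "\<epsilon> > (0::real)"
  shows "\<exists>\<^sub>F n in sequentially. 1 - \<epsilon> \<le> 1 / real n * (\<Sum>i<n. of_bool (P i))"
  unfolding frequently_sequentially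
proof
  fix N
  obtain M0 :: nat where M0: "1 / real (Suc M0) < \<epsilon>" using assms(2) nat_approx_posE by blast
  \<comment> \<open>The summand \<open>Suc M0\<close> keeps the fraction \<open>a / b\<close> below
    \<epsilon>; the summand \<open>N\<close> makes the run end after time \<open>N\<close>.\<close>
  define M where "M = Suc M0 + N"
  obtain a b where ab: "M \<le> a" "M * (a + 1) \<le> b" "\<And>i. a \<le> i \<Longrightarrow> i < b \<Longrightarrow> P i"
    using assms unfolding long_runs_def by meson
  have "a + 1 \<le> M * (a + 1)" using mult_le_mono1[of 1 M "a + 1"] by (simp add: M_def)
  then have "a < b" using ab by linarith
  have "real b - real a = (\<Sum>i\<in>{a..<b}. of_bool (P i))" using ab \<open>a < b\<close> by simp
  also have "\<dots> \<le> (\<Sum>i<b. of_bool (P i))" by (rule sum_mono2) auto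
  finally have 1: "real b - real a \<le> (\<Sum>i<b. of_bool (P i))" .
  have "real (Suc M0) * real a \<le> real M * (real a + 1)"
    by (intro mult_mono) (auto simp: M_def)
  also have "\<dots> \<le> real b" using ab(2) by (metis of_nat_1 of_nat_add of_nat_le_iff of_nat_mult)
  finally have "real a / real b \<le> 1 / real (Suc M0)"
    using \<open>a < b\<close> by (simp add: field_simps)
  then have "1 - \<epsilon> \<le> 1 - real a / real b"
    using M0 by linarith
  also have "\<dots> = 1 / real b * (real b - real a)"
    using \<open>a < b\<close> by (simp add: field_simps)
  also have "\<dots> \<le> 1 / real b * (\<Sum>i<b. of_bool (P i))"
    by (intro mult_left_mono 1) auto
  finally show "\<exists>n\<ge>N. 1 - \<epsilon> \<le> 1 / real n * (\<Sum>i<n. of_bool (P i))"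
    using ab(1) \<open>a < b\<close> by (intro exI[of _ b]) (auto simp: M_def)
qed

section \<open>Upper and lower limits along long runs\<close>

lemma le_limsup_frequently:
  fixes u :: "nat \<Rightarrow> 'a::complete_linorder"
  assumes "\<exists>\<^sub>F n in sequentially. C \<le> u n"
  shows "C \<le> limsup u"
  unfolding limsup_INF_SUP
proof (rule INF_greatest)
  fix n
  obtain m where "m \<ge> n" "C \<le> u m" using assms unfolding frequently_sequentially by blast
  then show "C \<le> (SUP m\<in>{n..}. u m)" by (intro SUP_upper2[of m]) auto
qed

lemma liminf_le_frequently:
  fixes u :: "nat \<Rightarrow> 'a::complete_linorder"
  assumes "\<exists>\<^sub>F n in sequentially. u n \<le> C"
  shows "liminf u \<le> C"
  unfolding liminf_SUP_INF
proof (rule SUP_least)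
  fix n
  obtain m where "m \<ge> n" "u m \<le> C" using assms unfolding frequently_sequentially by blast
  then show "(INF m\<in>{n..}. u m) \<le> C" by (intro INF_lower2[of m]) auto
qed

lemma limsup_frequency_eq_1:
  assumes "long_runs P"
  shows "limsup (\<lambda>n. ereal (1 / real n * (\<Sum>i<n. of_bool (P i)))) = 1"
proof (rule antisym)
  have "(\<Sum>i<n. of_bool (P i)) \<le> real n" for n
    using sum_bounded_above[of "{..<n}" "\<lambda>i. of_bool (P i)" "1::real"] by auto
  then have "1 / real n * (\<Sum>i<n. of_bool (P i)) \<le> 1" for n
    by (cases "n = 0") (auto simp: field_simps)
  then show "limsup (\<lambda>n. ereal (1 / real n * (\<Sum>i<n. of_bool (P i)))) \<le> 1"
    by (intro Limsup_bounded always_eventually) (simp add: one_ereal_def)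
  have "1 \<le> limsup (\<lambda>n. ereal (1 / real n * (\<Sum>i<n. of_bool (P i)))) + ereal e" if "e > 0" for e
  proof -
    have "ereal (1 - e) \<le> limsup (\<lambda>n. ereal (1 / real n * (\<Sum>i<n. of_bool (P i))))"
      using long_runs_frequency[OF assms that]
      by (intro le_limsup_frequently) (simp only: ereal_less_eq)
    then have "ereal (1 - e) + ereal e
        \<le> limsup (\<lambda>n. ereal (1 / real n * (\<Sum>i<n. of_bool (P i)))) + ereal e"
      by (rule add_right_mono)
    then show ?thesis by (simp add: one_ereal_def)
  qed
  then show "1 \<le> limsup (\<lambda>n. ereal (1 / real n * (\<Sum>i<n. of_bool (P i))))"
    by (rule ereal_le_epsilon2)
qed

text \<open>The frequencies of \<open>P\<close> and of its negation add up to 1, so a frequency of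
  the negation near 1 makes that of \<open>P\<close> small.\<close>

lemma liminf_frequency_eq_0:
  assumes "long_runs (\<lambda>i. \<not> P i)"
  shows "liminf (\<lambda>n. ereal (1 / real n * (\<Sum>i<n. of_bool (P i)))) = 0"
proof (rule antisym)
  show "0 \<le> liminf (\<lambda>n. ereal (1 / real n * (\<Sum>i<n. of_bool (P i))))"
    by (intro Liminf_bounded always_eventually) (auto simp: zero_ereal_def sum_nonneg)
  have "liminf (\<lambda>n. ereal (1 / real n * (\<Sum>i<n. of_bool (P i)))) \<le> 0 + ereal e" if "e > 0" for e
  proof -
    have *: "1 / real n * (\<Sum>i<n. of_bool (P i)) \<le> e"
      if "1 - e \<le> 1 / real n * (\<Sum>i<n. of_bool (\<not> P i))" for n
    proof (cases "n = 0")
      case False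
      have "(\<Sum>i<n. of_bool (P i)) + (\<Sum>i<n. of_bool (\<not> P i)) = (\<Sum>i<n. 1 :: real)"
        unfolding sum.distrib[symmetric] by (rule sum.cong) auto
      then have "(\<Sum>i<n. of_bool (\<not> P i)) = real n - (\<Sum>i<n. of_bool (P i))" by simp
      then show ?thesis using that False by (simp add: field_simps)
    \<comment> \<open>At \<open>n = 0\<close> the frequency is 0, because division by zero yields
      0.\<close>
    qed (use \<open>e > 0\<close> in auto)
    have "liminf (\<lambda>n. ereal (1 / real n * (\<Sum>i<n. of_bool (P i)))) \<le> ereal e"
      by (intro liminf_le_frequently frequently_mono[OF _ long_runs_frequency[OF assms that]])
         (use * in simp)
    then show ?thesis by simp
  qed
  then show "liminf (\<lambda>n. ereal (1 / real n * (\<Sum>i<n. of_bool (P i)))) \<le> 0"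
    by (rule ereal_le_epsilon2)
qed

section \<open>Subadditive sequences\<close>

lemma subadditive_mult:
  fixes a :: "nat \<Rightarrow> real"
  assumes "\<And>m n. a (m + n) \<le> a m + a n"
  shows "a (q * m + r) \<le> q * a m + a r"
proof (induction q)
  case (Suc q)
  have "a (Suc q * m + r) \<le> a m + a (q * m + r)" using assms[of m "q * m + r"] by (simp add: ac_simps)
  then show ?case using Suc by (simp add: algebra_simps)
qed simp

text \<open>Fekete's lemma. The limit is the infimum of the ratios, finite because they are
  nonnegative: if \<open>m\<close> nearly attains it, cutting \<open>n\<close> into pieces of length
  \<open>m\<close> and a remainder bounds \<open>a n / n\<close> by \<open>a m / m\<close> plus an
  error of order \<open>1 / n\<close>.\<close>

lemma subadditive_convergent:
  fixes a :: "nat \<Rightarrow> real"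
  assumes sub: "\<And>m n. a (m + n) \<le> a m + a n" and pos: "\<And>n. a n \<ge> 0"
  shows "convergent (\<lambda>n. a n / n)"
proof -
  let ?S = "(\<lambda>n. a n / real n) ` {1..}"
  define l where "l = Inf ?S"
  have bdd: "bdd_below ?S" using pos by (intro bdd_belowI2[of _ 0]) auto
  have lower: "l \<le> a n / n" if "n \<ge> 1" for n
    unfolding l_def using that by (intro cInf_lower bdd) auto
  have "(\<lambda>n. a n / n) \<longlonglongrightarrow> l"
  proof (rule LIMSEQ_I)
    fix r :: real assume "r > 0"
    then have "Inf ?S < l + r / 2" by (simp add: l_def)
    then obtain m where m: "m \<ge> 1" "a m / m < l + r / 2"
      by (subst (asm) cInf_less_iff[OF _ bdd]) auto
    \<comment> \<open>A bound, independent of \<open>n\<close>, for the remainder term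
      \<open>a (n mod m)\<close>.\<close>
    define B where "B = Max (a ` {..<m})"
    have B: "a i \<le> B" if "i < m" for i unfolding B_def using that by auto
    have "B \<ge> 0" using B[of 0] pos[of 0] m(1) by linarith
    obtain N :: nat where N: "2 * B / r < N" using reals_Archimedean2 by blast
    have "a n / n < l + r" if n: "n \<ge> Suc N" for n
    proof -
      have "a n \<le> (n div m) * a m + a (n mod m)"
        using subadditive_mult[of a "n div m" m "n mod m"] sub by simp
      also have "\<dots> \<le> (n / m) * a m + B"
        using B[of "n mod m"] m(1) pos[of m] of_nat_div_le_of_nat[of n m]
        by (intro add_mono mult_right_mono) auto
      finally have "a n / n \<le> a m / m + B / n"
        using n m(1) by (simp add: field_simps)
      also have "B / n < r / 2 "
      proof -
        have "2 * B / r < n" using N n by linarith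
        then show ?thesis using \<open>r > 0\<close> n by (simp add: field_simps)
      qed
      finally show ?thesis using m(2) by simp
    qed
    moreover have "l \<le> a n / n" if "n \<ge> Suc N" for n using lower that by simp
    ultimately have "norm (a n / n - l) < r" if "n \<ge> Suc N" for n
      using that \<open>r > 0\<close> by (fastforce simp: abs_less_iff)
    then show "\<exists>no. \<forall>n\<ge>no. norm (a n / n - l) < r" by blast
  qed
  then show ?thesis by (auto simp: convergent_def)
qed

section \<open>Coding by itineraries\<close>

lemma shift_space_shift: "s \<in> shift_space A \<Longrightarrow> shift s \<in> shift_space A"
  by (simp add: shift_space_def shift_def)

lemma shift_space_add: "s \<in> shift_space A \<Longrightarrow> (\<lambda>j. s (j + k)) \<in> shift_space A"
  by (simp add: shift_space_def)

lemma shift_space_Cons: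
  assumes "s \<in> shift_space A" "A $ i $ s 0 = 1"
  shows "case_nat i s \<in> shift_space A"
  using assms by (auto simp: shift_space_def split: nat.split)

lemma sum_zero_one_pos_ex:
  fixes g :: "'n::finite \<Rightarrow> real"
  assumes "\<And>j. g j \<in> {0, 1}" "(\<Sum>j\<in>UNIV. g j) \<ge> 1"
  shows "\<exists>j. g j = 1"
proof (rule ccontr)
  assume "\<nexists>j. g j = 1"
  then have "g j = 0" for j using assms(1)[of j] by auto
  then show False using assms(2) by simp
qed

lemma transition_matrix_succ:
  assumes "transition_matrix A"
  shows "\<exists>j. A $ i $ j = 1"
  using assms sum_zero_one_pos_ex[of "\<lambda>j. A $ i $ j"] unfolding transition_matrix_def by blast

lemma transition_matrix_pred:
  assumes "transition_matrix A"
  shows "\<exists>i. A $ i $ j = 1"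
  using assms sum_zero_one_pos_ex[of "\<lambda>i. A $ i $ j"] unfolding transition_matrix_def by blast

text \<open>Row sums of at least one give every symbol a successor; iterating a fixed choice of
  successors is admissible.\<close>

lemma shift_space_start:
  assumes "transition_matrix A"
  obtains s where "s \<in> shift_space A" "s 0 = i"
proof -
  obtain nxt where nxt: "A $ i $ nxt i = 1" for i
    using transition_matrix_succ[OF assms] by metis
  show ?thesis
    by (rule that[of "\<lambda>k. (nxt ^^ k) i"]) (auto simp: shift_space_def nxt)
qed

text \<open>What the coding uses of the hypotheses. The bounds \<open>D\<close> and \<eta> do not
  depend on the time; they come from the finitely many fixed bounded sets, at positive mutual
  distances, that contain the sets \<open>W i n\<close>.\<close>

locale expanding_coding =
  fixes f :: "nat \<Rightarrow> 'a::metric_space \<Rightarrow> 'a"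
    and A :: "real^'n^'n"
    and W :: "'n \<Rightarrow> nat \<Rightarrow> 'a set"
    and c D \<eta> :: real
  assumes matrix: "transition_matrix A"
    and nonempty: "W i n \<noteq> {}"
    and compact_W: "compact (W i n)"
    and equi_cont: "equi_continuous_in dist dist (\<lambda>_. \<Union>n. \<Union>i. W i n) f"
    and covering: "A $ i $ j = 1 \<Longrightarrow> W j (Suc n) \<subseteq> f n ` W i n"
    and c_gt_1: "c > 1"
    and expanding: "x \<in> W i n \<Longrightarrow> y \<in> W i n \<Longrightarrow> c * dist x y \<le> dist (f n x) (f n y)"
    and diameter: "x \<in> W i n \<Longrightarrow> y \<in> W i n \<Longrightarrow> dist x y \<le> D"
    and \<eta>_pos: "\<eta> > 0"
    and separated: "i \<noteq> j \<Longrightarrow> x \<in> W i n \<Longrightarrow> y \<in> W j n \<Longrightarrow> \<eta> \<le> dist x y"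
begin

lemma continuous_on_W: "continuous_on (W i n) (f n)"
  unfolding continuous_on_iff
proof (intro ballI allI impI)
  fix x and \<epsilon> :: real assume x: "x \<in> W i n" and "\<epsilon> > 0"
  then obtain \<delta> where "\<delta> > 0"
    "\<And>m x y. x \<in> (\<Union>n. \<Union>i. W i n) \<Longrightarrow> y \<in> (\<Union>n. \<Union>i. W i n) \<Longrightarrow> dist x y < \<delta> \<Longrightarrow> dist (f m x) (f m y) < \<epsilon>"
    using equi_cont unfolding equi_continuous_in_def by meson
  then show "\<exists>\<delta>>0. \<forall>x'\<in>W i n. dist x' x < \<delta> \<longrightarrow> dist (f n x') (f n x) < \<epsilon>"
    using x by blast
qed

lemma orbit_expanding:
  assumes "\<And>k. k \<le> m \<Longrightarrow> orbit_map f n k x \<in> W (s k) (n + k)"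
    and "\<And>k. k \<le> m \<Longrightarrow> orbit_map f n k y \<in> W (s k) (n + k)"
    and "k \<le> m"
  shows "c ^ k * dist x y \<le> dist (orbit_map f n k x) (orbit_map f n k y)"
  using \<open>k \<le> m\<close>
proof (induction k)
  case (Suc k)
  have "c ^ Suc k * dist x y = c * (c ^ k * dist x y)" by simp
  also have "\<dots> \<le> c * dist (orbit_map f n k x) (orbit_map f n k y)"
    using Suc c_gt_1 by (intro mult_left_mono) auto
  also have "\<dots> \<le> dist (orbit_map f n (Suc k) x) (orbit_map f n (Suc k) y)"
    using expanding assms(1,2)[of k] Suc.prems by simp
  finally show ?case .
qed simp

text \<open>Along a common itinerary each step expands by \<open>c\<close>, and after
  \<open>m\<close> steps the distance is still at most \<open>D\<close>. This estimate yields
  existence, uniqueness and continuity of the coding.\<close>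

lemma dist_le_of_itinerary:
  assumes "\<And>k. k \<le> m \<Longrightarrow> orbit_map f n k x \<in> W (s k) (n + k)"
    and "\<And>k. k \<le> m \<Longrightarrow> orbit_map f n k y \<in> W (s k) (n + k)"
  shows "dist x y \<le> D / c ^ m"
proof -
  have "c ^ m * dist x y \<le> dist (orbit_map f n m x) (orbit_map f n m y)"
    using assms by (rule orbit_expanding) auto
  also have "\<dots> \<le> D" using assms[of m] by (intro diameter) auto
  finally show ?thesis using c_gt_1 by (simp add: field_simps)
qed

text \<open>Pulls back from the end of the word: a point at time \<open>n + 1\<close> following the
  shifted word has, by covering, a preimage in the set of the first symbol. Hence the induction
  varies both \<open>n\<close> and \<open>s\<close>.\<close>

lemma ex_finite_itinerary:
  "s \<in> shift_space A \<Longrightarrow> \<exists>x. \<forall>k\<le>m. orbit_map f n k x \<in> W (s k) (n + k)"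
proof (induction m arbitrary: n s)
  case 0
  show ?case using nonempty[of "s 0" n] by auto
next
  case (Suc m)
  obtain y where y: "\<And>k. k \<le> m \<Longrightarrow> orbit_map f (Suc n) k y \<in> W (shift s k) (Suc n + k)"
    using Suc.IH[OF shift_space_shift[OF Suc.prems], of "Suc n"] by blast
  have "A $ s 0 $ s 1 = 1" using Suc.prems by (auto simp: shift_space_def)
  moreover have "y \<in> W (s 1) (Suc n)" using y[of 0] by (simp add: shift_def)
  ultimately obtain x where x: "x \<in> W (s 0) n" "y = f n x" using covering by blast
  have "orbit_map f n k x \<in> W (s k) (n + k)" if "k \<le> Suc m" for k
  proof (cases k)
    case (Suc k')
    then show ?thesis using y[of k'] x that
      by (simp add: orbit_map_Suc_right shift_def del: orbit_map.simps(2))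
  qed (use x in simp)
  then show ?case by blast
qed

text \<open>Points following \<open>s\<close> for longer and longer times form a Cauchy sequence by
  expansion. Its limit lies in the compact set of the first symbol and inherits the whole itinerary
  by continuity.\<close>

lemma ex_itinerary:
  assumes s: "s \<in> shift_space A"
  shows "\<exists>x. \<forall>k. orbit_map f n k x \<in> W (s k) (n + k)"
proof -
  have "\<forall>m. \<exists>x. \<forall>k\<le>m. orbit_map f n k x \<in> W (s k) (n + k)"
    using ex_finite_itinerary[OF s] by blast
  from choice[OF this] obtain X
    where X: "\<And>m k. k \<le> m \<Longrightarrow> orbit_map f n k (X m) \<in> W (s k) (n + k)" by blast
  have "Cauchy X"
  proof (rule metric_CauchyI)
    fix e :: real assume "e > 0"
    then obtain M where M: "D / c ^ M < e" using inverse_power_less_ex[OF c_gt_1] by blast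
    have "dist (X p) (X q) < e" if "p \<ge> M" "q \<ge> M" for p q
    proof -
      have "dist (X p) (X q) \<le> D / c ^ M"
        by (rule dist_le_of_itinerary[of M n _ s]) (use X that in auto)
      with M show ?thesis by simp
    qed
    then show "\<exists>M. \<forall>p\<ge>M. \<forall>q\<ge>M. dist (X p) (X q) < e" by blast
  qed
  moreover have "X m \<in> W (s 0) n" for m using X[of 0 m] by simp
  moreover have "complete (W (s 0) n)" by (rule compact_imp_complete[OF compact_W])
  ultimately obtain x where x: "x \<in> W (s 0) n" "X \<longlonglongrightarrow> x" unfolding complete_def by blast
  \<comment> \<open>Convergence and membership are proved together: \<open>f (n + k)\<close> is
    continuous only on the sets \<open>W i (n + k)\<close>, so the limit must be known to lie there
    before the next map is applied.\<close>
  have "(\<lambda>m. orbit_map f n k (X m)) \<longlonglongrightarrow> orbit_map f n k x \<and> orbit_map f n k x \<in> W (s k) (n + k)" for k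
  proof (induction k)
    case (Suc k)
    have "\<forall>\<^sub>F m in sequentially. orbit_map f n k (X m) \<in> W (s k) (n + k)"
      using X eventually_sequentially by blast
    then have lim: "(\<lambda>m. orbit_map f n (Suc k) (X m)) \<longlonglongrightarrow> orbit_map f n (Suc k) x"
      using continuous_on_tendsto_compose[OF continuous_on_W] Suc by fastforce
    have "\<forall>\<^sub>F m in sequentially. orbit_map f n (Suc k) (X m) \<in> W (s (Suc k)) (n + Suc k)"
      using X eventually_sequentially by blast
    with lim have "orbit_map f n (Suc k) x \<in> W (s (Suc k)) (n + Suc k)"
      by (intro Lim_in_closed_set[OF compact_imp_closed[OF compact_W]]) auto
    with lim show ?case by blast
  qed (use x in auto)
  then show ?thesis by blast
qed

lemma itinerary_unique:
  assumes "\<And>k. orbit_map f n k x \<in> W (s k) (n + k)" "\<And>k. orbit_map f n k y \<in> W (s k) (n + k)"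
  shows "x = y"
proof (rule ccontr)
  assume "x \<noteq> y"
  then obtain m where "D / c ^ m < dist x y"
    using inverse_power_less_ex[OF c_gt_1, of "dist x y"] by auto
  then show False using dist_le_of_itinerary[of m n x s y] assms by auto
qed

text \<open>The inverse of the coding at time \<open>n\<close>. The description is meaningful for
  admissible \<open>s\<close>, where existence and uniqueness hold.\<close>

definition point :: "nat \<Rightarrow> (nat \<Rightarrow> 'n) \<Rightarrow> 'a" where
  "point n s = (THE x. \<forall>k. orbit_map f n k x \<in> W (s k) (n + k))"

lemma point_itinerary:
  assumes "s \<in> shift_space A"
  shows "orbit_map f n k (point n s) \<in> W (s k) (n + k)"
proof -
  have "\<exists>!x. \<forall>k. orbit_map f n k x \<in> W (s k) (n + k)"
    using ex_itinerary[OF assms] itinerary_unique by (intro ex_ex1I) blast+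
  from theI'[OF this] show ?thesis unfolding point_def by blast
qed

lemma point_eqI:
  assumes "s \<in> shift_space A" "\<And>k. orbit_map f n k x \<in> W (s k) (n + k)"
  shows "point n s = x"
  using itinerary_unique[OF point_itinerary[OF assms(1)] assms(2)] .

lemma point_mem: "s \<in> shift_space A \<Longrightarrow> point n s \<in> W (s 0) n"
  using point_itinerary[of s n 0] by simp

lemma f_point:
  assumes "s \<in> shift_space A"
  shows "f n (point n s) = point (Suc n) (shift s)"
proof (rule point_eqI[symmetric])
  fix k
  show "orbit_map f (Suc n) k (f n (point n s)) \<in> W (shift s k) (Suc n + k)"
    using point_itinerary[OF assms, of n "Suc k"]
    by (simp add: orbit_map_Suc_right shift_def del: orbit_map.simps(2))
qed (rule shift_space_shift[OF assms])

lemma orbit_point: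
  assumes "s \<in> shift_space A"
  shows "orbit_map f n k (point n s) = point (n + k) (\<lambda>j. s (j + k))"
proof (induction k)
  case (Suc k)
  then show ?case
    using f_point[OF shift_space_add[OF assms], of "n + k" k] by (simp add: shift_def)
qed simp

lemma point_close:
  assumes "s \<in> shift_space A" "t \<in> shift_space A" "\<And>j. j \<le> K \<Longrightarrow> s j = t j"
  shows "dist (point n s) (point n t) \<le> D / c ^ K"
proof (rule dist_le_of_itinerary[of K n _ s])
  fix k assume "k \<le> K"
  then show "orbit_map f n k (point n t) \<in> W (s k) (n + k)"
    using assms(3) point_itinerary[OF assms(2), of n k] by metis
qed (rule point_itinerary[OF assms(1)])

text \<open>Equi-continuity of the decoding maps: \<open>K\<close> serves all \<open>n\<close> at
  once since it depends on \<open>D\<close> and \<open>c\<close> only.\<close>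

lemma point_close_uniform:
  assumes "\<epsilon> > 0"
  obtains K where "\<And>n s t. s \<in> shift_space A \<Longrightarrow> t \<in> shift_space A \<Longrightarrow> (\<And>j. j < K \<Longrightarrow> s j = t j) \<Longrightarrow>
    dist (point n s) (point n t) < \<epsilon>"
proof -
  obtain K where K: "D / c ^ K < \<epsilon>" using inverse_power_less_ex[OF c_gt_1 assms] by blast
  show ?thesis
  proof (rule that[of "Suc K"])
    fix n s t assume "s \<in> shift_space A" "t \<in> shift_space A" "\<And>j. j < Suc K \<Longrightarrow> s j = t j"
    then show "dist (point n s) (point n t) < \<epsilon>"
      using point_close[of s t K n] K by fastforce
  qed
qed

text \<open>Points closer than \<eta> share the first symbol. By equi-continuity their images are
  also close, so the induction hypothesis applies to the shifted codes. This gives injectivity and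
  equi-continuity of the coding, and later the separation of orbits.\<close>

lemma point_separated:
  "\<exists>\<delta>>0. \<forall>n. \<forall>s\<in>shift_space A. \<forall>t\<in>shift_space A.
     dist (point n s) (point n t) < \<delta> \<longrightarrow> (\<forall>j<K. s j = t j)"
proof (induction K)
  case (Suc K)
  then obtain e where e: "e > 0" "\<And>n s t j. s \<in> shift_space A \<Longrightarrow> t \<in> shift_space A \<Longrightarrow>
      dist (point n s) (point n t) < e \<Longrightarrow> j < K \<Longrightarrow> s j = t j"
    by blast
  obtain \<delta> where \<delta>: "\<delta> > 0"
    "\<And>n x y. x \<in> (\<Union>n. \<Union>i. W i n) \<Longrightarrow> y \<in> (\<Union>n. \<Union>i. W i n) \<Longrightarrow> dist x y < \<delta> \<Longrightarrow> dist (f n x) (f n y) < e"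
    using equi_cont \<open>e > 0\<close> unfolding equi_continuous_in_def by meson
  have "s j = t j"
    if s: "s \<in> shift_space A" and t: "t \<in> shift_space A"
      and d: "dist (point n s) (point n t) < min \<delta> \<eta>" and j: "j < Suc K" for n s t j
  proof (cases j)
    case 0
    then show ?thesis
      using separated[OF _ point_mem[OF s, of n] point_mem[OF t, of n]] d 0
      by (cases "s 0 = t 0") auto
  next
    case (Suc i)
    have "dist (f n (point n s)) (f n (point n t)) < e"
      using point_mem[OF s] point_mem[OF t] d by (intro \<delta>) auto
    then have "shift s i = shift t i"
      using Suc j e(2)[OF s[THEN shift_space_shift] t[THEN shift_space_shift]] s t
      by (simp add: f_point)
    then show ?thesis using Suc by (simp add: shift_def)
  qed
  then show ?case using \<delta>(1) \<eta>_pos by (intro exI[of _ "min \<delta> \<eta>"]) auto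
qed (auto intro: exI[of _ 1])

lemma inj_on_point: "inj_on (point n) (shift_space A)"
proof (rule inj_onI, rule ext)
  fix s t j
  assume "s \<in> shift_space A" "t \<in> shift_space A" "point n s = point n t"
  then show "s j = t j" using point_separated[of "Suc j"] by (metis dist_self lessI)
qed

section \<open>The limit sets and the equi-conjugacy\<close>

definition limit_set :: "nat \<Rightarrow> 'a set" where
  "limit_set n = point n ` shift_space A"

lemma limit_set_nonempty: "limit_set n \<noteq> {}"
  using shift_space_start[OF matrix] unfolding limit_set_def by blast

lemma limit_set_subset: "limit_set n \<subseteq> (\<Union>i. W i n)"
  using point_mem unfolding limit_set_def by blast

lemma f_limit_set: "f n ` limit_set n = limit_set (Suc n)"
proof
  show "f n ` limit_set n \<subseteq> limit_set (Suc n)"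
    unfolding limit_set_def by (auto simp: f_point shift_space_shift)
  show "limit_set (Suc n) \<subseteq> f n ` limit_set n"
  proof
    fix y assume "y \<in> limit_set (Suc n)"
    then obtain t where t: "t \<in> shift_space A" "y = point (Suc n) t" unfolding limit_set_def by blast
    \<comment> \<open>Column sums of at least one give \<open>t 0\<close> a predecessor, so
      \<open>t\<close> is the shift of an admissible sequence.\<close>
    obtain i where "A $ i $ t 0 = 1" using transition_matrix_pred[OF matrix] by blast
    then have "case_nat i t \<in> shift_space A" by (rule shift_space_Cons[OF t(1)])
    then show "y \<in> f n ` limit_set n"
      unfolding limit_set_def using f_point[of "case_nat i t" n] t(2)
      by (intro image_eqI[of _ _ "point n (case_nat i t)"]) (auto simp: shift_def)
  qed
qed

text \<open>A sequence of points has a convergent subsequence in the compact union of the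
  \<open>W i n\<close>. Being Cauchy, it forces each symbol of the codes to stabilise, and the
  stable symbols form the code of the limit.\<close>

lemma compact_limit_set: "compact (limit_set n)"
  unfolding compact_def
proof (intro allI impI)
  fix X :: "nat \<Rightarrow> 'a" assume X: "\<forall>m. X m \<in> limit_set n"
  have "compact (\<Union>i. W i n)" using compact_W by (intro compact_UN) auto
  moreover have "\<forall>m. X m \<in> (\<Union>i. W i n)" using X limit_set_subset by blast
  ultimately obtain x r where r: "strict_mono r" "(X \<circ> r) \<longlonglongrightarrow> x"
    unfolding compact_def by metis
  have "\<forall>m. \<exists>s. s \<in> shift_space A \<and> X (r m) = point n s"
    using X unfolding limit_set_def by blast
  from choice[OF this] obtain S
    where S: "\<And>m. S m \<in> shift_space A" "\<And>m. X (r m) = point n (S m)" by blast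
  have "\<exists>N. \<forall>m\<ge>N. \<forall>j<K. S m j = S N j" for K
  proof -
    obtain \<delta> where "\<delta> > 0" "\<forall>n. \<forall>s\<in>shift_space A. \<forall>t\<in>shift_space A.
        dist (point n s) (point n t) < \<delta> \<longrightarrow> (\<forall>j<K. s j = t j)"
      using point_separated by blast
    moreover obtain N where "\<And>m. m \<ge> N \<Longrightarrow> dist ((X \<circ> r) m) ((X \<circ> r) N) < \<delta>"
      using LIMSEQ_imp_Cauchy[OF r(2)] \<open>\<delta> > 0\<close> unfolding Cauchy_altdef2 by blast
    ultimately show ?thesis using S by (metis comp_apply)
  qed
  then obtain N where N: "\<And>K m j. m \<ge> N K \<Longrightarrow> j < K \<Longrightarrow> S m j = S (N K) j" by metis
  \<comment> \<open>Symbol \<open>j\<close> is final once the first \<open>Suc j\<close> symbols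
    have stabilised.\<close>
  define s where "s j = S (N (Suc j)) j" for j
  have s_eq: "S m j = s j" if "j < K" "m \<ge> N K" for j m K
  proof -
    define m' where "m' = max (N K) (N (Suc j))"
    have "S m j = S m' j" using N[OF _ that(1)] that(2) unfolding m'_def by (metis max.cobounded1)
    also have "\<dots> = s j" unfolding s_def by (rule N) (auto simp: m'_def)
    finally show ?thesis .
  qed
  have s: "s \<in> shift_space A"
    unfolding shift_space_def
  proof safe
    fix j
    \<comment> \<open>Both symbols are read off one admissible sequence,
      \<open>S (N (Suc (Suc j)))\<close>, so the transition between them is allowed.\<close>
    show "A $ s j $ s (Suc j) = 1"
      using S(1)[of "N (Suc (Suc j))"] s_eq[of j "Suc (Suc j)"] s_eq[of "Suc j" "Suc (Suc j)"]
      unfolding shift_space_def by (metis (mono_tags, lifting) lessI less_SucI mem_Collect_eq order_refl)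
  qed
  have "(X \<circ> r) \<longlonglongrightarrow> point n s"
  proof (rule metric_LIMSEQ_I)
    fix e :: real assume "e > 0"
    then obtain K where K: "\<And>n s t. s \<in> shift_space A \<Longrightarrow> t \<in> shift_space A \<Longrightarrow>
        (\<And>j. j < K \<Longrightarrow> s j = t j) \<Longrightarrow> dist (point n s) (point n t) < e"
      using point_close_uniform by metis
    then show "\<exists>no. \<forall>m\<ge>no. dist ((X \<circ> r) m) (point n s) < e"
      using s S s_eq by (intro exI[of _ "N K"]) auto
  qed
  then have "x = point n s" using r(2) LIMSEQ_unique by blast
  then show "\<exists>l\<in>limit_set n. \<exists>r. strict_mono r \<and> (X \<circ> r) \<longlonglongrightarrow> l"
    using r s unfolding limit_set_def by blast
qed

text \<open>The conjugacies invert \<open>point n\<close>. Their equi-continuity is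
  \<open>point_separated\<close>, that of their inverses is
  \<open>point_close_uniform\<close>.\<close>

lemma equi_conjugate_limit_set: "equi_conjugate_to_shift f limit_set A"
proof -
  define h where "h n = inv_into (shift_space A) (point n)" for n
  have h: "h n (point n s) = s" if "s \<in> shift_space A" for n s
    unfolding h_def using inj_on_point that by (rule inv_into_f_f)
  have bij: "bij_betw (h n) (limit_set n) (shift_space A)" for n
    unfolding h_def limit_set_def using inj_on_point
    by (intro bij_betw_inv_into) (simp add: bij_betw_def)
  have inv: "inv_into (limit_set n) (h n) s = point n s" if "s \<in> shift_space A" for n s
    using bij[of n] that h[OF that]
    by (intro inv_into_f_eq) (auto simp: bij_betw_def limit_set_def)
  show ?thesis
    unfolding equi_conjugate_to_shift_def
  proof (intro conjI exI[of _ h] allI ballI)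
    show "f n ` limit_set n \<subseteq> limit_set (Suc n)" for n using f_limit_set by blast
    show "h (Suc n) (f n x) = shift (h n x)" if "x \<in> limit_set n" for n x
      using that h f_point shift_space_shift unfolding limit_set_def by force
    show "equi_continuous_in dist shift_dist limit_set h"
    proof (rule equi_continuous_in_shift_dist)
      show "\<exists>\<delta>>0. \<forall>n. \<forall>x\<in>limit_set n. \<forall>y\<in>limit_set n.
          dist x y < \<delta> \<longrightarrow> (\<forall>j<K. h n x j = h n y j)" for K
        using point_separated[of K] h unfolding limit_set_def by (simp cong: ball_cong)
    qed
    show "equi_continuous_in shift_dist dist (\<lambda>n. shift_space A) (\<lambda>n. inv_into (limit_set n) (h n))"
      unfolding equi_continuous_in_def
    proof (intro allI impI)
      fix \<epsilon> :: real assume "\<epsilon> > 0"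
      then obtain K where K: "\<And>n s t. s \<in> shift_space A \<Longrightarrow> t \<in> shift_space A \<Longrightarrow>
          (\<And>j. j < K \<Longrightarrow> s j = t j) \<Longrightarrow> dist (point n s) (point n t) < \<epsilon>"
        using point_close_uniform by metis
      show "\<exists>\<delta>>0. \<forall>n. \<forall>s\<in>shift_space A. \<forall>t\<in>shift_space A. shift_dist s t < \<delta> \<longrightarrow>
          dist (inv_into (limit_set n) (h n) s) (inv_into (limit_set n) (h n) t) < \<epsilon>"
        by (intro exI[of _ "1 / 2 ^ K"])
           (auto simp: inv intro!: K intro: shift_dist_less_imp_eq[of _ _ K])
    qed
  qed (use bij in auto)
qed

end

section \<open>Chaos\<close>

lemma matrix_pow_nonneg:
  assumes "\<And>i j. A $ i $ j \<ge> 0"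
  shows "matrix_pow A k $ i $ j \<ge> 0"
proof (induction k arbitrary: i j)
  case (Suc k)
  then show ?case
    using assms by (auto simp: matrix_matrix_mult_def intro!: sum_nonneg)
qed (simp add: mat_def)

text \<open>A positive entry of the product has a positive summand, which supplies the first edge
  and, by induction, the rest of the path.\<close>

lemma matrix_pow_pos_path:
  assumes "\<And>i j. A $ i $ j \<in> {0, 1}" "matrix_pow A k $ i $ j > 0"
  shows "\<exists>p. p 0 = i \<and> p k = j \<and> (\<forall>t<k. A $ p t $ p (Suc t) = 1)"
  using assms(2)
proof (induction k arbitrary: i)
  case 0
  then show ?case by (intro exI[of _ "\<lambda>_. i"]) (auto simp: mat_def split: if_splits)
next
  case (Suc k)
  have "(\<Sum>l\<in>UNIV. A $ i $ l * matrix_pow A k $ l $ j) > 0"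
    using Suc.prems by (simp add: matrix_matrix_mult_def)
  then obtain l where l: "A $ i $ l * matrix_pow A k $ l $ j > 0"
    by (metis (no_types, lifting) linorder_not_le sum_nonpos)
  then have "A $ i $ l = 1" "matrix_pow A k $ l $ j > 0"
    using assms(1)[of i l] by auto
  moreover from Suc.IH[OF this(2)] obtain p
    where "p 0 = l" "p k = j" "\<forall>t<k. A $ p t $ p (Suc t) = 1" by blast
  ultimately show ?case
    by (intro exI[of _ "case_nat i p"]) (auto split: nat.split)
qed

text \<open>Closed walks; the total function \<open>u\<close> is constrained only on the indices up
  to \<open>l\<close>.\<close>

definition loop_at :: "real^'n^'n \<Rightarrow> 'n \<Rightarrow> nat \<Rightarrow> (nat \<Rightarrow> 'n) \<Rightarrow> bool" where
  "loop_at A i l u \<longleftrightarrow> u 0 = i \<and> u l = i \<and> (\<forall>t<l. A $ u t $ u (Suc t) = 1)"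

lemma loop_at_append:
  assumes "loop_at A i k u" "loop_at A i l v"
  shows "loop_at A i (k + l) (\<lambda>t. if t < k then u t else v (t - k))"
  unfolding loop_at_def
proof (intro conjI allI impI)
  fix t assume t: "t < k + l"
  \<comment> \<open>The middle case is the seam, where \<open>u\<close> ends at \<open>i\<close> and
    \<open>v\<close> starts there.\<close>
  consider "Suc t < k" | "Suc t = k" | "k \<le> t" by linarith
  then show "A $ (if t < k then u t else v (t - k)) $ (if Suc t < k then u (Suc t) else v (Suc t - k)) = 1"
  proof cases
    case 2
    then have "v 0 = u (Suc t)" using assms by (simp add: loop_at_def)
    then show ?thesis using 2 assms by (auto simp: loop_at_def)
  qed (use assms t in \<open>auto simp: loop_at_def Suc_diff_le\<close>)
qed (use assms in \<open>auto simp: loop_at_def\<close>)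

text \<open>Two loops leaving \<open>i\<close> through different edges give, composed in both orders, two distinct
  loops of the same length.\<close>

lemma ex_distinct_loops:
  assumes "\<And>i j. A $ i $ j \<in> {0, 1}" "irreducible_matrix A" "(\<Sum>j\<in>UNIV. A $ i $ j) \<ge> 2"
  obtains u v l r where "loop_at A i l u" "loop_at A i l v" "r < l" "u r \<noteq> v r"
proof -
  \<comment> \<open>The edge to \<open>j\<close> is followed by a return path from irreducibility.
    That path has at least one edge, whence \<open>1 < k\<close>.\<close>
  have loop: "\<exists>u k. loop_at A i k u \<and> u 1 = j \<and> 1 < k" if j: "A $ i $ j = 1" for j
  proof -
    obtain k where k: "k \<ge> 1" "matrix_pow A k $ j $ i > 0"
      using assms(2) unfolding irreducible_matrix_def by blast
    obtain p where p: "p 0 = j" "p k = i" "\<forall>t<k. A $ p t $ p (Suc t) = 1"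
      using matrix_pow_pos_path[OF assms(1) k(2)] by blast
    show ?thesis
      using k(1) p j by (intro exI[of _ "case_nat i p"] exI[of _ "Suc k"])
        (auto simp: loop_at_def split: nat.split)
  qed
  have "\<exists>j. A $ i $ j = 1"
    using assms(3) by (intro sum_zero_one_pos_ex[OF assms(1)]) linarith
  then obtain j1 where j1: "A $ i $ j1 = 1" by blast
  have "\<exists>j2. A $ i $ j2 = 1 \<and> j1 \<noteq> j2"
  proof (rule ccontr)
    assume "\<not> ?thesis"
    then have "A $ i $ j = (if j = j1 then 1 else 0)" for j
      using assms(1)[of i j] j1 by (metis empty_iff insert_iff)
    then have "(\<Sum>j\<in>UNIV. A $ i $ j) = (\<Sum>j\<in>UNIV. if j = j1 then 1 else 0)"
      by (simp only:)
    then show False using assms(3) by simp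
  qed
  then obtain j2 where j2: "A $ i $ j2 = 1" "j1 \<noteq> j2" by blast
  obtain u k where u: "loop_at A i k u" "u 1 = j1" "1 < k" using loop[OF j1] by blast
  obtain v l where v: "loop_at A i l v" "v 1 = j2" "1 < l" using loop[OF j2(1)] by blast
  show ?thesis
  proof (rule that)
    show "loop_at A i (k + l) (\<lambda>t. if t < k then u t else v (t - k))"
      using u(1) v(1) by (rule loop_at_append)
    show "loop_at A i (k + l) (\<lambda>t. if t < l then v t else u (t - l))"
      using loop_at_append[OF v(1) u(1)] by (simp add: add.commute)
    \<comment> \<open>Both first factors are longer than 1, so at index 1 the two compositions still
      read \<open>j1\<close> and \<open>j2\<close>.\<close>
    show "1 < k + l" "(if 1 < k then u 1 else v (1 - k)) \<noteq> (if 1 < l then v 1 else u (1 - l))"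
      using u v j2 by auto
  qed
qed

section \<open>Binary codes on factorially growing blocks\<close>

definition level :: "nat \<Rightarrow> nat" where
  "level q = (LEAST m. q < fact (Suc m))"

text \<open>Level \<open>m\<close> is the block from \<open>fact m\<close> up to
  \<open>fact (Suc m)\<close>; a smaller level would place \<open>q\<close> below
  \<open>fact m\<close>.\<close>

lemma level_eq:
  assumes "fact m \<le> q" "q < fact (Suc m)"
  shows "level q = m"
  unfolding level_def
proof (rule Least_equality)
  fix m' assume m': "q < fact (Suc m')"
  show "m \<le> m'"
  proof (rule ccontr)
    assume "\<not> m \<le> m'"
    then have "fact (Suc m') \<le> (fact m :: nat)" by (intro fact_mono_nat) auto
    then show False using m' assms by linarith
  qed
qed (rule assms)

text \<open>The first component of \<open>prod_decode\<close> takes every value infinitely often, so the codes of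
  distinct \<open>\<theta>\<close> are opposite on infinitely many odd levels.\<close>

definition code :: "(nat \<Rightarrow> bool) \<Rightarrow> nat \<Rightarrow> bool" where
  "code \<theta> q \<longleftrightarrow> odd (level q) \<and> \<theta> (fst (prod_decode (level q div 2)))"

text \<open>The block of level \<open>m\<close>, stretched by \<open>l\<close>, ends at
  \<open>m + 1\<close> times its start. Dropping the last \<open>K\<close> positions, so that
  windows of length \<open>K\<close> stay inside, does not spoil this growth.\<close>

lemma long_runs_level:
  assumes "\<And>N. \<exists>m\<ge>N. Q m" "l > 0"
    and "\<And>m i. Q m \<Longrightarrow> fact m * l \<le> i \<Longrightarrow> i + K \<le> fact (Suc m) * l \<Longrightarrow> P i"
  shows "long_runs P"
  unfolding long_runs_def
proof
  fix M
  \<comment> \<open>Since \<open>F\<close> is at least 1, \<open>M * (F + 1) + K\<close> is at most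
    \<open>(2 * M + K) * F\<close>, hence the choice of the bound.\<close>
  obtain m where m: "m \<ge> 2 * M + K" "Q m" using assms(1) by blast
  define F :: nat where "F = fact m * l"
  have F: "F \<ge> 1" unfolding F_def using assms(2) by (simp add: Suc_le_eq)
  have "m \<le> fact m" by (rule fact_ge_self)
  also have "\<dots> \<le> F" using assms(2) by (simp add: F_def)
  finally have 1: "M \<le> F" using m(1) by linarith
  have "M * (F + 1) + K \<le> M * F + (M + K) * F" using F by (simp add: algebra_simps add_mono)
  also have "\<dots> = (2 * M + K) * F" by (simp add: algebra_simps)
  also have "\<dots> \<le> Suc m * F" using m(1) by (intro mult_right_mono) auto
  also have "\<dots> = fact (Suc m) * l" by (simp add: F_def algebra_simps)
  finally have 2: "M * (F + 1) + K \<le> fact (Suc m) * l" .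
  have "P i" if "F \<le> i" "i < fact (Suc m) * l - K" for i
    using that assms(3)[OF m(2), of i] unfolding F_def by linarith
  then show "\<exists>a b. M \<le> a \<and> M * (a + 1) \<le> b \<and> (\<forall>i. a \<le> i \<longrightarrow> i < b \<longrightarrow> P i)"
    using 1 2 by (intro exI[of _ F] exI[of _ "fact (Suc m) * l - K"]) auto
qed

definition block_seq :: "nat \<Rightarrow> (nat \<Rightarrow> 'n) \<Rightarrow> (nat \<Rightarrow> 'n) \<Rightarrow> (nat \<Rightarrow> bool) \<Rightarrow> nat \<Rightarrow> 'n" where
  "block_seq l u v \<alpha> i = (if \<alpha> (i div l) then u else v) (i mod l)"

text \<open>Inside a block the transitions are those of a loop; at a boundary every block ends and
  starts at the same vertex \<open>i\<close>, whichever loops meet.\<close>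

lemma block_seq_mem:
  assumes "loop_at A i l u" "loop_at A i l v" "l > 0"
  shows "block_seq l u v \<alpha> \<in> shift_space A"
  unfolding shift_space_def
proof safe
  fix j
  define w where "w = (if \<alpha> (j div l) then u else v)"
  have w: "loop_at A i l w" using assms by (simp add: w_def)
  have j: "block_seq l u v \<alpha> j = w (j mod l)" by (simp add: block_seq_def w_def)
  have "block_seq l u v \<alpha> (Suc j) = w (Suc (j mod l))"
  proof (cases "Suc (j mod l) = l")
    case True
    then have "Suc j mod l = 0" by (simp add: mod_Suc)
    then show ?thesis using assms w True by (auto simp: block_seq_def loop_at_def)
  next
    case False
    then show ?thesis by (simp add: block_seq_def w_def mod_Suc div_Suc)
  qed
  moreover have "j mod l < l" using assms(3) by simp
  ultimately show "A $ block_seq l u v \<alpha> j $ block_seq l u v \<alpha> (Suc j) = 1"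
    using w j unfolding loop_at_def by simp
qed

lemma div_bounds:
  assumes "(a::nat) * l \<le> i" "i < b * l"
  shows "a \<le> i div l" "i div l < b"
  using assms by (auto simp: less_mult_imp_div_less) (metis div_le_mono div_mult_self_is_m gr_zeroI mult_0_right not_less_zero)

text \<open>On even levels every code is false, so all sequences repeat \<open>v\<close>
  there.\<close>

lemma long_runs_agree:
  assumes "l > 0"
  shows "long_runs (\<lambda>i. \<forall>j<K. block_seq l u v (code \<theta>) (i + j) = block_seq l u v (code \<theta>') (i + j))"
proof (rule long_runs_level[where Q = even and l = l and K = K])
  show "\<exists>m\<ge>N. even m" for N :: nat by (rule exI[of _ "2 * N"]) auto
next
  fix m i assume m: "even (m::nat)" and i: "fact m * l \<le> i" "i + K \<le> fact (Suc m) * l"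
  have "level ((i + j) div l) = m" if "j < K" for j
    using i that div_bounds[of "fact m" l "i + j" "fact (Suc m)"] by (intro level_eq) linarith+
  then show "\<forall>j<K. block_seq l u v (code \<theta>) (i + j) = block_seq l u v (code \<theta>') (i + j)"
    using m by (auto simp: block_seq_def code_def)
qed (rule assms)

text \<open>On the odd levels assigned to an argument \<open>q\<close> where \<theta> and \<theta>'
  differ, one sequence repeats \<open>u\<close> and the other \<open>v\<close>. Every window of
  length \<open>l\<close> meets the residue \<open>r\<close> modulo \<open>l\<close>, where the
  loops differ.\<close>

lemma long_runs_differ:
  assumes "r < l" "u r \<noteq> v r" "\<theta> \<noteq> \<theta>'"
  shows "long_runs (\<lambda>i. \<exists>j<l. block_seq l u v (code \<theta>) (i + j) \<noteq> block_seq l u v (code \<theta>') (i + j))"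
proof -
  obtain q where q: "\<theta> q \<noteq> \<theta>' q" using assms(3) by blast
  show ?thesis
  proof (rule long_runs_level[where Q = "\<lambda>m. odd m \<and> fst (prod_decode (m div 2)) = q" and l = l and K = l])
    show "\<exists>m\<ge>N. odd m \<and> fst (prod_decode (m div 2)) = q" for N :: nat
      \<comment> \<open>\<open>prod_encode (q, N)\<close> is at least \<open>N\<close>; doubling and
        adding 1 makes the level odd and leaves the code recoverable by
        \<open>div 2\<close>.\<close>
      using le_prod_encode_2[of N q] by (intro exI[of _ "2 * prod_encode (q, N) + 1"]) auto
    show "l > 0" using assms by simp
  next
    fix m i assume m: "odd (m::nat) \<and> fst (prod_decode (m div 2)) = q"
      and i: "fact m * l \<le> i" "i + l \<le> fact (Suc m) * l"
    \<comment> \<open>The distance from \<open>i\<close> to the next index congruent to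
      \<open>r\<close> modulo \<open>l\<close>.\<close>
    define j where "j = (if i mod l \<le> r then r - i mod l else l + r - i mod l)"
    have j: "j < l" using assms by (auto simp: j_def)
    have "(i + j) mod l = (i mod l + j) mod l" by (simp add: mod_simps)
    also have "\<dots> = r" using assms mod_less_divisor[of l i] by (auto simp: j_def simp del: mod_less_divisor)
    finally have "(i + j) mod l = r" .
    moreover have "level ((i + j) div l) = m"
      using i j div_bounds[of "fact m" l "i + j" "fact (Suc m)"] by (intro level_eq) linarith+
    ultimately have "block_seq l u v (code \<theta>) (i + j) \<noteq> block_seq l u v (code \<theta>') (i + j)"
      using m q assms(2) by (auto simp: block_seq_def code_def)
    with j show "\<exists>j<l. block_seq l u v (code \<theta>) (i + j) \<noteq> block_seq l u v (code \<theta>') (i + j)" by blast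
  qed
qed

text \<open>Cantor's diagonal argument.\<close>

lemma uncountable_nat_bool: "uncountable (UNIV :: (nat \<Rightarrow> bool) set)"
proof
  assume "countable (UNIV :: (nat \<Rightarrow> bool) set)"
  then obtain g :: "nat \<Rightarrow> nat \<Rightarrow> bool" where "range g = UNIV"
    using uncountable_def by blast
  then obtain n where "g n = (\<lambda>k. \<not> g k k)" by (metis UNIV_I imageE)
  then show False by (metis (full_types))
qed

section \<open>The scrambled set\<close>

context expanding_coding
begin

lemma long_runs_close:
  assumes "s \<in> shift_space A" "t \<in> shift_space A" "\<epsilon> > 0"
    and "\<And>K. long_runs (\<lambda>i. \<forall>j<K. s (i + j) = t (i + j))"
  shows "long_runs (\<lambda>i. dist (orbit_map f 0 i (point 0 s)) (orbit_map f 0 i (point 0 t)) < \<epsilon>)"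
proof -
  obtain K where K: "\<And>n s t. s \<in> shift_space A \<Longrightarrow> t \<in> shift_space A \<Longrightarrow> (\<And>j. j < K \<Longrightarrow> s j = t j) \<Longrightarrow>
    dist (point n s) (point n t) < \<epsilon>"
    using point_close_uniform[OF assms(3)] by metis
  have "dist (point i (\<lambda>j. s (j + i))) (point i (\<lambda>j. t (j + i))) < \<epsilon>"
    if "\<forall>j<K. s (i + j) = t (i + j)" for i
    using that by (intro K shift_space_add assms) (simp add: add.commute)
  then show ?thesis
    by (intro long_runs_mono[OF assms(4)[of K]]) (simp add: orbit_point assms)
qed

text \<open>Contraposition of \<open>point_separated\<close>, applied to shifted codes. The bound
  depends on \<open>K\<close> only, so one \<delta> serves all pairs.\<close>

lemma long_runs_apart:
  obtains \<delta> where "\<delta> > 0" "\<And>s t. s \<in> shift_space A \<Longrightarrow> t \<in> shift_space A \<Longrightarrow>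
      long_runs (\<lambda>i. \<exists>j<K. s (i + j) \<noteq> t (i + j)) \<Longrightarrow>
      long_runs (\<lambda>i. \<not> dist (orbit_map f 0 i (point 0 s)) (orbit_map f 0 i (point 0 t)) < \<delta>)"
proof -
  obtain \<delta> where \<delta>: "\<delta> > 0" "\<And>n s t j. s \<in> shift_space A \<Longrightarrow> t \<in> shift_space A \<Longrightarrow>
      dist (point n s) (point n t) < \<delta> \<Longrightarrow> j < K \<Longrightarrow> s j = t j"
    using point_separated[of K] by blast
  show ?thesis
  proof (rule that[OF \<delta>(1)])
    fix s t assume s: "s \<in> shift_space A" and t: "t \<in> shift_space A"
      and runs: "long_runs (\<lambda>i. \<exists>j<K. s (i + j) \<noteq> t (i + j))"
    show "long_runs (\<lambda>i. \<not> dist (orbit_map f 0 i (point 0 s)) (orbit_map f 0 i (point 0 t)) < \<delta>)"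
    proof (rule long_runs_mono[OF runs])
      fix i assume "\<exists>j<K. s (i + j) \<noteq> t (i + j)"
      then show "\<not> dist (orbit_map f 0 i (point 0 s)) (orbit_map f 0 i (point 0 t)) < \<delta>"
        using \<delta>(2)[OF shift_space_add[OF s] shift_space_add[OF t], of i i i]
        by (auto simp: orbit_point s t add.commute)
    qed
  qed
qed

text \<open>A single set serves every notion of chaos: the points coded by the block sequences of
  all binary \<theta>. Both properties are phrased as long runs, which yield limits of distances as
  well as of frequencies.\<close>

lemma ex_chaotic_set:
  assumes "irreducible_matrix A" "(\<Sum>j\<in>UNIV. A $ i $ j) \<ge> 2"
  obtains S \<delta> where "S \<subseteq> limit_set 0" "uncountable S" "\<delta> > 0"
    and "\<And>x y \<epsilon>. x \<in> S \<Longrightarrow> y \<in> S \<Longrightarrow> x \<noteq> y \<Longrightarrow> \<epsilon> > 0 \<Longrightarrow>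
      long_runs (\<lambda>i. dist (orbit_map f 0 i x) (orbit_map f 0 i y) < \<epsilon>)"
    and "\<And>x y. x \<in> S \<Longrightarrow> y \<in> S \<Longrightarrow> x \<noteq> y \<Longrightarrow>
      long_runs (\<lambda>i. \<not> dist (orbit_map f 0 i x) (orbit_map f 0 i y) < \<delta>)"
proof -
  have zero_one: "A $ i $ j \<in> {0, 1}" for i j
    using matrix unfolding transition_matrix_def by blast
  obtain u v l r where loops: "loop_at A i l u" "loop_at A i l v" "r < l" "u r \<noteq> v r"
    by (rule ex_distinct_loops[OF zero_one assms])
  define \<Phi> where "\<Phi> \<theta> = block_seq l u v (code \<theta>)" for \<theta>
  have mem: "\<Phi> \<theta> \<in> shift_space A" for \<theta>
    unfolding \<Phi>_def using loops by (intro block_seq_mem) auto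
  have agree: "long_runs (\<lambda>i. \<forall>j<K. \<Phi> \<theta> (i + j) = \<Phi> \<theta>' (i + j))" for K \<theta> \<theta>'
    unfolding \<Phi>_def using loops by (intro long_runs_agree) auto
  have differ: "long_runs (\<lambda>i. \<exists>j<l. \<Phi> \<theta> (i + j) \<noteq> \<Phi> \<theta>' (i + j))" if "\<theta> \<noteq> \<theta>'" for \<theta> \<theta>'
    unfolding \<Phi>_def using loops(3,4) that by (rule long_runs_differ)
  obtain \<delta> where \<delta>: "\<delta> > 0" "\<And>s t. s \<in> shift_space A \<Longrightarrow> t \<in> shift_space A \<Longrightarrow>
      long_runs (\<lambda>i. \<exists>j<l. s (i + j) \<noteq> t (i + j)) \<Longrightarrow>
      long_runs (\<lambda>i. \<not> dist (orbit_map f 0 i (point 0 s)) (orbit_map f 0 i (point 0 t)) < \<delta>)"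
    by (rule long_runs_apart[of l]) blast
  have apart: "long_runs (\<lambda>i. \<not> dist (orbit_map f 0 i (point 0 (\<Phi> \<theta>))) (orbit_map f 0 i (point 0 (\<Phi> \<theta>'))) < \<delta>)"
    if "\<theta> \<noteq> \<theta>'" for \<theta> \<theta>'
    by (intro \<delta>(2) mem differ that)
  \<comment> \<open>Different \<theta> give orbits at distance at least \<delta> at some time, so
    the points cannot coincide.\<close>
  have "inj (\<lambda>\<theta>. point 0 (\<Phi> \<theta>))"
  proof (rule injI, rule ccontr)
    fix \<theta> \<theta>' assume "point 0 (\<Phi> \<theta>) = point 0 (\<Phi> \<theta>')" "\<theta> \<noteq> \<theta>'"
    then have "long_runs (\<lambda>i. \<not> 0 < \<delta>)" using apart by fastforce
    then show False using \<delta>(1) long_runs_frequently by force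
  qed
  then have "uncountable (range (\<lambda>\<theta>. point 0 (\<Phi> \<theta>)))"
    using uncountable_nat_bool countable_image_inj_eq by blast
  then show ?thesis
  proof (rule that[rotated, OF _ \<delta>(1)])
    show "range (\<lambda>\<theta>. point 0 (\<Phi> \<theta>)) \<subseteq> limit_set 0" using mem unfolding limit_set_def by blast
    fix x y \<epsilon>
    assume "x \<in> range (\<lambda>\<theta>. point 0 (\<Phi> \<theta>))" "y \<in> range (\<lambda>\<theta>. point 0 (\<Phi> \<theta>))" "x \<noteq> y"
    then obtain \<theta> \<theta>' where xy: "x = point 0 (\<Phi> \<theta>)" "y = point 0 (\<Phi> \<theta>')" "\<theta> \<noteq> \<theta>'" by blast
    show "long_runs (\<lambda>i. \<not> dist (orbit_map f 0 i x) (orbit_map f 0 i y) < \<delta>)"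
      unfolding xy(1,2) using xy(3) by (rule apart)
    show "long_runs (\<lambda>i. dist (orbit_map f 0 i x) (orbit_map f 0 i y) < \<epsilon>)" if "\<epsilon> > 0"
      unfolding xy(1,2) by (rule long_runs_close[OF mem mem that agree])
  qed
qed

lemma bounded_orbit:
  assumes "x \<in> limit_set 0" "\<And>i. bounded (\<Union>n. W i n)"
  shows "bounded (range (\<lambda>n. orbit_map f 0 n x))"
proof (rule bounded_subset)
  show "bounded (\<Union>i. \<Union>n. W i n)" using assms(2) by (intro bounded_UN) auto
  show "range (\<lambda>n. orbit_map f 0 n x) \<subseteq> (\<Union>i. \<Union>n. W i n)"
    using assms(1) point_itinerary[of _ 0] unfolding limit_set_def by force
qed

lemma chaos:
  assumes "irreducible_matrix A" "(\<Sum>j\<in>UNIV. A $ i $ j) \<ge> 2" "\<And>i. bounded (\<Union>n. W i n)"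
  shows "\<exists>\<delta>>0. li_yorke_chaotic f \<delta>" "strongly_li_yorke_chaotic f" "distributionally_chaotic f"
proof -
  obtain S \<delta> where S: "S \<subseteq> limit_set 0" "uncountable S" "\<delta> > 0"
    and close: "\<And>x y \<epsilon>. x \<in> S \<Longrightarrow> y \<in> S \<Longrightarrow> x \<noteq> y \<Longrightarrow> \<epsilon> > 0 \<Longrightarrow>
      long_runs (\<lambda>i. dist (orbit_map f 0 i x) (orbit_map f 0 i y) < \<epsilon>)"
    and apart: "\<And>x y. x \<in> S \<Longrightarrow> y \<in> S \<Longrightarrow> x \<noteq> y \<Longrightarrow>
      long_runs (\<lambda>i. \<not> dist (orbit_map f 0 i x) (orbit_map f 0 i y) < \<delta>)"
    by (rule ex_chaotic_set[OF assms(1,2)]) (rule that)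
  \<comment> \<open>The upper limit is shown to be at least \<delta>, while scrambling asks for a
    strict inequality; hence half of \<delta>.\<close>
  have scrambled: "li_yorke_scrambled f (\<delta> / 2) S"
    unfolding li_yorke_scrambled_def
  proof (intro conjI ballI impI)
    fix x y assume xy: "x \<in> S" "y \<in> S" "x \<noteq> y"
    let ?d = "\<lambda>n. ereal (dist (orbit_map f 0 n x) (orbit_map f 0 n y))"
    show "liminf ?d = 0"
    proof (rule antisym)
      have "liminf ?d \<le> 0 + ereal e" if "e > 0" for e
        using long_runs_frequently[OF close[OF xy that]]
        by (intro liminf_le_frequently) (auto elim!: frequently_mono[rotated])
      then show "liminf ?d \<le> 0" by (rule ereal_le_epsilon2)
    qed (intro Liminf_bounded always_eventually, simp)
    have "ereal (\<delta> / 2) < ereal \<delta>" using S(3) by simp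
    also have "\<dots> \<le> limsup ?d"
      using long_runs_frequently[OF apart[OF xy]]
      by (intro le_limsup_frequently) (auto elim!: frequently_mono[rotated])
    finally show "ereal (\<delta> / 2) < limsup ?d" .
  qed (rule S)
  with S(3) show "\<exists>\<delta>>0. li_yorke_chaotic f \<delta>"
    unfolding li_yorke_chaotic_def by (intro exI[of _ "\<delta> / 2"]) auto
  show "strongly_li_yorke_chaotic f"
    unfolding strongly_li_yorke_chaotic_def using S scrambled bounded_orbit assms(3)
    by (intro exI[of _ "\<delta> / 2"] conjI exI[of _ S]) auto
  have freq: "proximity_frequency f \<epsilon> x y n
      = 1 / real n * (\<Sum>i<n. of_bool (dist (orbit_map f 0 i x) (orbit_map f 0 i y) < \<epsilon>))" for \<epsilon> x y n
    unfolding proximity_frequency_def by (simp add: indicator_def)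
  show "distributionally_chaotic f"
    unfolding distributionally_chaotic_def freq
  proof (intro exI[of _ S] conjI ballI impI allI)
    fix x y assume xy: "x \<in> S" "y \<in> S" "x \<noteq> y"
    show "limsup (\<lambda>n. ereal (1 / real n * (\<Sum>i<n. of_bool (dist (orbit_map f 0 i x) (orbit_map f 0 i y) < \<epsilon>)))) = 1"
      if "\<epsilon> > 0" for \<epsilon>
      by (rule limsup_frequency_eq_1[OF close[OF xy that]])
    show "\<exists>\<delta>>0. liminf (\<lambda>n. ereal (1 / real n * (\<Sum>i<n. of_bool (dist (orbit_map f 0 i x) (orbit_map f 0 i y) < \<delta>)))) = 0"
      using S(3) liminf_frequency_eq_0[OF apart[OF xy]] by blast
  qed (rule S)
qed

end

section \<open>Entropy\<close>

text \<open>Words of \<open>k + 1\<close> symbols have \<open>k\<close> transitions, matching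
  \<open>matrix_pow A k\<close>. They are taken as prefixes of infinite sequences, so each one is
  the beginning of the code of a point.\<close>

definition words_from :: "real^'n^'n \<Rightarrow> nat \<Rightarrow> 'n \<Rightarrow> 'n list set" where
  "words_from A k i = (\<lambda>s. map s [0..<Suc k]) ` {s \<in> shift_space A. s 0 = i}"

definition words :: "real^'n^'n \<Rightarrow> nat \<Rightarrow> 'n list set" where
  "words A k = (\<lambda>s. map s [0..<Suc k]) ` shift_space A"

lemma map_upt_shift: "map s [0..<Suc (Suc k)] = s 0 # map (shift s) [0..<Suc k]"
proof -
  have "map s [0..<Suc (Suc k)] = s 0 # map s (map Suc [0..<Suc k])"
    by (simp only: map_Suc_upt upt_conv_Cons[of 0 "Suc (Suc k)"] list.map zero_less_Suc)
  then show ?thesis by (simp only: map_map comp_def shift_def)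
qed

lemma words_from_0:
  assumes "transition_matrix A"
  shows "words_from A 0 i = {[i]}"
  using shift_space_start[OF assms, of i] unfolding words_from_def by auto

lemma words_from_Suc:
  "words_from A (Suc k) i = (\<Union>l\<in>{l. A $ i $ l = 1}. (#) i ` words_from A k l)" (is "?L = ?R")
proof
  show "?L \<subseteq> ?R"
  proof
    fix w assume "w \<in> ?L"
    then obtain s where s: "s \<in> shift_space A" "s 0 = i" "w = map s [0..<Suc (Suc k)]"
      unfolding words_from_def by blast
    have "A $ i $ shift s 0 = 1" using s by (auto simp: shift_space_def shift_def)
    moreover have "map (shift s) [0..<Suc k] \<in> words_from A k (shift s 0)"
      unfolding words_from_def using shift_space_shift[OF s(1)] by blast
    ultimately show "w \<in> ?R" using s(2,3) unfolding map_upt_shift by blast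
  qed
  show "?R \<subseteq> ?L"
  proof
    fix w assume "w \<in> ?R"
    then obtain t where t: "A $ i $ t 0 = 1" "t \<in> shift_space A" "w = i # map t [0..<Suc k]"
      unfolding words_from_def by blast
    have "shift (case_nat i t) = t" by (simp add: shift_def)
    then have "w = map (case_nat i t) [0..<Suc (Suc k)]"
      unfolding map_upt_shift t(3) by simp
    moreover have "case_nat i t \<in> shift_space A" using t by (intro shift_space_Cons)
    ultimately show "w \<in> ?L" unfolding words_from_def by (intro image_eqI[of _ _ "case_nat i t"]) auto
  qed
qed

lemma finite_words_from: "finite (words_from (A :: real^'n^'n) k i)"
proof (rule finite_subset)
  show "words_from A k i \<subseteq> {w. set w \<subseteq> UNIV \<and> length w = Suc k}"
    unfolding words_from_def by auto
  show "finite {w :: 'n list. set w \<subseteq> UNIV \<and> length w = Suc k}"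
    by (rule finite_lists_length_eq) simp
qed

lemma hd_words_from: "w \<in> words_from A k i \<Longrightarrow> hd w = i"
  unfolding words_from_def by (auto simp: upt_conv_Cons simp del: upt_Suc)

text \<open>Splitting by the second symbol is a disjoint union over the successors of
  \<open>i\<close>. As the entries are 0 or 1, this is the recursion for row sums of matrix
  powers.\<close>

lemma card_words_from:
  assumes "transition_matrix A"
  shows "real (card (words_from A k i)) = (\<Sum>j\<in>UNIV. matrix_pow A k $ i $ j)"
proof (induction k arbitrary: i)
  case 0
  then show ?case by (simp add: words_from_0[OF assms] mat_def)
next
  case (Suc k)
  have zero_one: "A $ i $ l = (if A $ i $ l = 1 then 1 else 0)" for l
    using assms unfolding transition_matrix_def by (metis empty_iff insert_iff)
  have "card (words_from A (Suc k) i) = (\<Sum>l\<in>{l. A $ i $ l = 1}. card ((#) i ` words_from A k l))"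
    unfolding words_from_Suc
    by (intro card_UN_disjoint) (auto simp: finite_words_from dest!: hd_words_from)
  also have "\<dots> = (\<Sum>l\<in>{l. A $ i $ l = 1}. card (words_from A k l))"
    by (simp add: card_image)
  finally have "real (card (words_from A (Suc k) i))
      = (\<Sum>l\<in>{l. A $ i $ l = 1}. \<Sum>j\<in>UNIV. matrix_pow A k $ l $ j)"
    using Suc.IH by simp
  also have "\<dots> = (\<Sum>l\<in>UNIV. (if A $ i $ l = 1 then 1 else 0) * (\<Sum>j\<in>UNIV. matrix_pow A k $ l $ j))"
    by (intro sum.mono_neutral_cong_left) auto
  also have "\<dots> = (\<Sum>l\<in>UNIV. A $ i $ l * (\<Sum>j\<in>UNIV. matrix_pow A k $ l $ j))"
    by (simp only: zero_one[symmetric])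
  also have "\<dots> = (\<Sum>j\<in>UNIV. \<Sum>l\<in>UNIV. A $ i $ l * matrix_pow A k $ l $ j)"
    unfolding sum_distrib_left by (rule sum.swap)
  finally show ?case by (simp add: matrix_matrix_mult_def)
qed

lemma words_eq: "words A k = (\<Union>i. words_from A k i)"
  unfolding words_def words_from_def by blast

lemma finite_words: "finite (words (A :: real^'n^'n) k)"
  unfolding words_eq by (simp add: finite_words_from)

lemma card_words:
  assumes "transition_matrix (A :: real^'n^'n)"
  shows "real (card (words A k)) = entry_sum (matrix_pow A k)"
proof -
  have "card (words A k) = (\<Sum>i\<in>UNIV. card (words_from A k i))"
    unfolding words_eq
    by (intro card_UN_disjoint) (auto simp: finite_words_from dest!: hd_words_from)
  then show ?thesis by (simp add: card_words_from[OF assms] entry_sum_def)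
qed

section \<open>Growth of the number of words\<close>

lemma entry_sum_ge_1:
  assumes "transition_matrix A"
  shows "entry_sum (matrix_pow A k) \<ge> 1"
proof -
  have "words A k \<noteq> {}" using shift_space_start[OF assms] unfolding words_def by blast
  then have "card (words A k) \<ge> 1" using finite_words[of A k] by (simp add: Suc_le_eq card_gt_0_iff)
  then show ?thesis by (simp flip: card_words[OF assms])
qed

lemma matrix_pow_add: "matrix_pow A (m + n) = matrix_pow A m ** matrix_pow A n"
  by (induction m) (simp_all add: matrix_mul_assoc)

text \<open>Each row sum of the nonnegative matrix \<open>C\<close> is at most its total.\<close>

lemma entry_sum_mult_le:
  assumes "\<And>i j. B $ i $ j \<ge> 0" "\<And>i j. C $ i $ j \<ge> 0"
  shows "entry_sum (B ** C) \<le> entry_sum B * entry_sum C"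
proof -
  have "entry_sum (B ** C) = (\<Sum>i\<in>UNIV. \<Sum>l\<in>UNIV. B $ i $ l * (\<Sum>j\<in>UNIV. C $ l $ j))"
    unfolding entry_sum_def matrix_matrix_mult_def sum_distrib_left
    by (simp, intro sum.cong refl sum.swap)
  also have "\<dots> \<le> (\<Sum>i\<in>UNIV. \<Sum>l\<in>UNIV. B $ i $ l * entry_sum C)"
    using assms unfolding entry_sum_def
    by (intro sum_mono mult_left_mono member_le_sum sum_nonneg) auto
  finally show ?thesis by (simp add: entry_sum_def sum_distrib_right)
qed

lemma ln_entry_sum_add_le:
  assumes "transition_matrix A"
  shows "ln (entry_sum (matrix_pow A (m + n))) \<le> ln (entry_sum (matrix_pow A m)) + ln (entry_sum (matrix_pow A n))"
proof -
  have "A $ i $ j \<in> {0, 1}" for i j using assms unfolding transition_matrix_def by blast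
  then have "A $ i $ j \<ge> 0" for i j by (metis empty_iff insert_iff order_refl zero_le_one)
  then have "entry_sum (matrix_pow A (m + n)) \<le> entry_sum (matrix_pow A m) * entry_sum (matrix_pow A n)"
    unfolding matrix_pow_add by (intro entry_sum_mult_le matrix_pow_nonneg)
  moreover have "entry_sum (matrix_pow A k) > 0" for k
    using entry_sum_ge_1[OF assms, of k] by linarith
  ultimately show ?thesis by (simp flip: ln_mult_pos)
qed

text \<open>Fekete's lemma applies since the logarithms are subadditive and nonnegative.
  Exponentiating shows that the \<open>lim\<close> in \<open>growth_rate\<close> is a genuine
  limit.\<close>

lemma ln_entry_sum_tendsto:
  assumes "transition_matrix A"
  shows "(\<lambda>n. ln (entry_sum (matrix_pow A n)) / n) \<longlonglongrightarrow> ln (growth_rate A)"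
proof -
  let ?w = "\<lambda>n. entry_sum (matrix_pow A n)"
  have w: "?w n \<ge> 1" for n by (rule entry_sum_ge_1[OF assms])
  have "convergent (\<lambda>n. ln (?w n) / n)"
    by (intro subadditive_convergent ln_entry_sum_add_le assms ln_ge_zero w)
  then obtain l where l: "(\<lambda>n. ln (?w n) / n) \<longlonglongrightarrow> l" unfolding convergent_def by blast
  then have "(\<lambda>n. exp (ln (?w n) / n)) \<longlonglongrightarrow> exp l" by (rule tendsto_exp)
  moreover have "\<forall>\<^sub>F n in sequentially. exp (ln (?w n) / n) = root n (?w n)"
  proof (rule eventually_mono[OF eventually_gt_at_top[of 0]])
    fix n :: nat assume "n > 0"
    moreover have "?w n > 0" using w[of n] by linarith
    ultimately show "exp (ln (?w n) / n) = root n (?w n)"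
      by (simp add: root_powr_inverse powr_def field_simps)
  qed
  ultimately have "(\<lambda>n. root n (?w n)) \<longlonglongrightarrow> exp l" by (rule Lim_transform_eventually)
  then have "growth_rate A = exp l" unfolding growth_rate_def by (rule limI)
  with l show ?thesis by simp
qed

section \<open>Cover numbers and the entropy of the limit set\<close>

lemma cover_number_le:
  "F \<subseteq> C \<Longrightarrow> finite F \<Longrightarrow> \<Union>F = Y \<Longrightarrow> cover_number C Y \<le> card F"
  unfolding cover_number_def by (rule cInf_lower) auto

lemma cover_number_attained:
  assumes "F \<subseteq> C" "finite F" "\<Union>F = Y"
  obtains G where "G \<subseteq> C" "finite G" "\<Union>G = Y" "cover_number C Y = card G"
proof -
  have "{card F | F. F \<subseteq> C \<and> finite F \<and> \<Union>F = Y} \<noteq> {}" using assms by blast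
  from Inf_nat_def1[OF this] show ?thesis using that unfolding cover_number_def by blast
qed

context expanding_coding
begin

text \<open>Let \<open>e\<close> be a Lebesgue number of the cover and let \<open>K\<close> common
  symbols force distance below \<open>e\<close>. Codes with the same word in
  \<open>words A (n + K)\<close> have orbits \<open>e\<close>-close at all times below
  \<open>n\<close>, so one element of the refined cover per word suffices.\<close>

lemma ex_subcover_card_le:
  assumes "compact (UNIV :: 'a set)" "open_cover \<A>"
  obtains K where "\<And>n. \<exists>F. F \<subseteq> restricted_cover (refined_cover f \<A> n) (limit_set 0) \<and> finite F \<and>
    \<Union>F = limit_set 0 \<and> card F \<le> card (words A (n + K))"
proof -
  obtain e where e: "e > 0" "\<And>x. \<exists>U\<in>\<A>. ball x e \<subseteq> U"
    using Heine_Borel_lemma[OF assms(1), of \<A>] assms(2) unfolding open_cover_def by auto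
  then obtain U where U: "\<And>x. U x \<in> \<A>" "\<And>x. ball x e \<subseteq> U x" by metis
  obtain K where K: "\<And>n s t. s \<in> shift_space A \<Longrightarrow> t \<in> shift_space A \<Longrightarrow> (\<And>j. j < K \<Longrightarrow> s j = t j) \<Longrightarrow>
    dist (point n s) (point n t) < e"
    using point_close_uniform[OF e(1)] by metis
  show ?thesis
  proof (rule that)
    fix n
    let ?pre = "\<lambda>s. map s [0..<Suc (n + K)]"
    obtain rep where rep: "\<And>w. w \<in> words A (n + K) \<Longrightarrow> rep w \<in> shift_space A \<and> ?pre (rep w) = w"
    proof -
      have "\<forall>w. \<exists>s. w \<in> words A (n + K) \<longrightarrow> s \<in> shift_space A \<and> ?pre s = w"
        unfolding words_def by blast
      from choice[OF this] show ?thesis using that by blast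
    qed
    \<comment> \<open>The element of the refined cover that follows the orbit of the representative
      of \<open>w\<close>.\<close>
    define G where "G w = (\<Inter>j\<in>{..<n}. orbit_map f 0 j -` U (orbit_map f 0 j (point 0 (rep w)))) \<inter> limit_set 0" for w
    have "G w \<in> restricted_cover (refined_cover f \<A> n) (limit_set 0)" for w
      unfolding restricted_cover_def refined_cover_def G_def using U(1)
      by (intro imageI CollectI exI[of _ "\<lambda>j. U (orbit_map f 0 j (point 0 (rep w)))"]) auto
    moreover have "(\<Union>w\<in>words A (n + K). G w) = limit_set 0"
    proof
      show "limit_set 0 \<subseteq> (\<Union>w\<in>words A (n + K). G w)"
      proof
        fix x assume x: "x \<in> limit_set 0"
        then obtain s where s: "s \<in> shift_space A" "x = point 0 s" unfolding limit_set_def by blast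
        then have w: "?pre s \<in> words A (n + K)" unfolding words_def by blast
        define t where "t = rep (?pre s)"
        have t: "t \<in> shift_space A" "?pre t = ?pre s" using rep[OF w] unfolding t_def by auto
        have eq: "t j = s j" if "j < Suc (n + K)" for j
          using arg_cong[OF t(2), of "\<lambda>w. w ! j"] that by (simp del: upt_Suc)
        have "orbit_map f 0 j x \<in> U (orbit_map f 0 j (point 0 t))" if "j < n" for j
        proof -
          \<comment> \<open>For \<open>j < n\<close> the first \<open>K\<close> symbols after
            \<open>j\<close> lie among the common ones.\<close>
          have "dist (point j (\<lambda>i. t (i + j))) (point j (\<lambda>i. s (i + j))) < e"
            using that by (intro K shift_space_add s t eq) auto
          then have "orbit_map f 0 j x \<in> ball (orbit_map f 0 j (point 0 t)) e"
            by (simp add: s orbit_point t(1))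
          then show ?thesis using U(2) by blast
        qed
        then have "x \<in> G (?pre s)" using x unfolding G_def t_def by auto
        with w show "x \<in> (\<Union>w\<in>words A (n + K). G w)" by blast
      qed
    qed (auto simp: G_def)
    moreover have "card (G ` words A (n + K)) \<le> card (words A (n + K))"
      by (rule card_image_le[OF finite_words])
    ultimately show "\<exists>F. F \<subseteq> restricted_cover (refined_cover f \<A> n) (limit_set 0) \<and> finite F \<and>
        \<Union>F = limit_set 0 \<and> card F \<le> card (words A (n + K))"
      using finite_words[of A "n + K"] by (intro exI[of _ "G ` words A (n + K)"]) auto
  qed
qed

text \<open>The \<open>K\<close> additional symbols cost at most a constant in the logarithm, which
  vanishes after division by \<open>n\<close>.\<close>

lemma entropy_le:
  assumes "compact (UNIV :: 'a set)" "open_cover \<A>"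
  shows "limsup (\<lambda>n. ereal (1 / real n *
    ln (real (cover_number (restricted_cover (refined_cover f \<A> n) (limit_set 0)) (limit_set 0)))))
    \<le> ereal (ln (growth_rate A))"
proof -
  let ?N = "\<lambda>n. cover_number (restricted_cover (refined_cover f \<A> n) (limit_set 0)) (limit_set 0)"
  let ?w = "\<lambda>n. entry_sum (matrix_pow A n)"
  obtain K where K: "\<And>n. \<exists>F. F \<subseteq> restricted_cover (refined_cover f \<A> n) (limit_set 0) \<and> finite F \<and>
      \<Union>F = limit_set 0 \<and> card F \<le> card (words A (n + K))"
    using ex_subcover_card_le[OF assms] by metis
  have "1 / real n * ln (real (?N n)) \<le> ln (?w n) / n + ln (?w K) / n" for n
  proof -
    have "?N n \<le> card (words A (n + K))" using K[of n] cover_number_le order_trans by metis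
    then have "real (?N n) \<le> ?w (n + K)" unfolding card_words[OF matrix, symmetric] by simp
    then have "ln (real (?N n)) \<le> ln (?w (n + K))"
      \<comment> \<open>A cover number 0 is harmless: \<open>ln 0\<close> is 0 and the right side is
        nonnegative.\<close>
      using entry_sum_ge_1[OF matrix, of "n + K"] by (cases "?N n = 0") auto
    also have "\<dots> \<le> ln (?w n) + ln (?w K)" by (rule ln_entry_sum_add_le[OF matrix])
    finally have "1 / real n * ln (real (?N n)) \<le> 1 / real n * (ln (?w n) + ln (?w K))"
      by (intro mult_left_mono) auto
    then show ?thesis by (simp add: add_divide_distrib)
  qed
  then have "limsup (\<lambda>n. ereal (1 / real n * ln (real (?N n)))) \<le> limsup (\<lambda>n. ereal (ln (?w n) / n + ln (?w K) / n))"
    by (intro Limsup_mono always_eventually) simp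
  also have "\<dots> = ereal (ln (growth_rate A))"
  proof (rule lim_imp_Limsup)
    have "(\<lambda>n. ln (?w n) / n + ln (?w K) / n) \<longlonglongrightarrow> ln (growth_rate A) + 0"
      by (intro tendsto_add ln_entry_sum_tendsto matrix lim_const_over_n)
    then show "(\<lambda>n. ereal (ln (?w n) / n + ln (?w K) / n)) \<longlonglongrightarrow> ereal (ln (growth_rate A))"
      by simp
  qed simp
  finally show ?thesis .
qed

text \<open>No element of the cover meets sets of two different symbols at the same time. Hence all
  points in one element of the refined cover share the first \<open>n + 1\<close> symbols, and a
  minimal subcover maps onto the words.\<close>

lemma separating_cover_number_ge:
  assumes "compact (UNIV :: 'a set)" "open_cover \<A>"
    and "\<And>U x y. U \<in> \<A> \<Longrightarrow> x \<in> U \<Longrightarrow> y \<in> U \<Longrightarrow> dist x y < \<eta>"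
  shows "card (words A n)
    \<le> cover_number (restricted_cover (refined_cover f \<A> (Suc n)) (limit_set 0)) (limit_set 0)"
proof -
  let ?C = "restricted_cover (refined_cover f \<A> (Suc n)) (limit_set 0)"
  \<comment> \<open>A finite subcover must exist for the infimum in \<open>cover_number\<close> to
    be attained.\<close>
  obtain F where "F \<subseteq> ?C" "finite F" "\<Union>F = limit_set 0"
    using ex_subcover_card_le[OF assms(1,2)] by metis
  then obtain G where G: "G \<subseteq> ?C" "finite G" "\<Union>G = limit_set 0"
    "cover_number ?C (limit_set 0) = card G"
    by (rule cover_number_attained)
  let ?pre = "\<lambda>s. map s [0..<Suc n]"
  have same: "?pre s = ?pre t"
    if "B \<in> G" and st: "s \<in> shift_space A" "t \<in> shift_space A"
      and "point 0 s \<in> B" "point 0 t \<in> B" for B s t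
  proof -
    have "B \<in> ?C" using that(1) G(1) by blast
    then obtain B' where B': "B' \<in> refined_cover f \<A> (Suc n)" "B = B' \<inter> limit_set 0"
      unfolding restricted_cover_def by blast
    then obtain U where U: "\<forall>j<Suc n. U j \<in> \<A>"
        "B' = (\<Inter>j\<in>{..<Suc n}. orbit_map f 0 j -` U j)"
      unfolding refined_cover_def by blast
    have "s j = t j" if j: "j < Suc n" for j
    proof (rule ccontr)
      assume "s j \<noteq> t j"
      then have "\<eta> \<le> dist (orbit_map f 0 j (point 0 s)) (orbit_map f 0 j (point 0 t))"
        by (rule separated[OF _ point_itinerary[OF st(1)] point_itinerary[OF st(2)]])
      moreover have "orbit_map f 0 j (point 0 s) \<in> U j" "orbit_map f 0 j (point 0 t) \<in> U j"
        using U(2) B'(2) j \<open>point 0 s \<in> B\<close> \<open>point 0 t \<in> B\<close> by auto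
      ultimately show False using assms(3) U(1) j by fastforce
    qed
    then show ?thesis by simp
  qed
  define g where "g B = ?pre (SOME s. s \<in> shift_space A \<and> point 0 s \<in> B)" for B
  have "words A n \<subseteq> g ` G"
  proof
    fix w assume "w \<in> words A n"
    then obtain s where s: "s \<in> shift_space A" "w = ?pre s" unfolding words_def by blast
    then have "point 0 s \<in> \<Union>G" unfolding G(3) limit_set_def by blast
    then obtain B where B: "B \<in> G" "point 0 s \<in> B" by blast
    define t where "t = (SOME s. s \<in> shift_space A \<and> point 0 s \<in> B)"
    have "t \<in> shift_space A \<and> point 0 t \<in> B"
      unfolding t_def by (rule someI[of _ s]) (use s B in blast)
    then have "?pre t = ?pre s" using same B s(1) by blast
    then have "g B = w" unfolding g_def t_def s(2) .
    with B(1) show "w \<in> g ` G" by blast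
  qed
  then have "card (words A n) \<le> card G" using G(2) by (rule surj_card_le[rotated])
  with G(4) show ?thesis by simp
qed

text \<open>Balls of radius \<eta>/2 form a separating cover. Observing \<open>n\<close> times sees
  \<open>n - 1\<close> transitions; the missing one costs
  \<open>ln (entry_sum (matrix_pow A 1)) / n\<close>, which tends to 0.\<close>

lemma entropy_ge:
  assumes "compact (UNIV :: 'a set)"
  shows "ereal (ln (growth_rate A)) \<le> topological_entropy f (limit_set 0)"
proof -
  define \<A> where "\<A> = range (\<lambda>x :: 'a. ball x (\<eta> / 2))"
  have "x \<in> \<Union>\<A>" for x
    unfolding \<A>_def using \<eta>_pos by (intro UnionI[of "ball x (\<eta> / 2)"]) auto
  then have cover: "open_cover \<A>"
    unfolding open_cover_def by (auto simp: \<A>_def)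
  have small: "dist x y < \<eta>" if "U \<in> \<A>" "x \<in> U" "y \<in> U" for U x y
    using that unfolding \<A>_def by (auto intro: dist_triangle_half_r)
  let ?N = "\<lambda>n. cover_number (restricted_cover (refined_cover f \<A> n) (limit_set 0)) (limit_set 0)"
  let ?w = "\<lambda>n. entry_sum (matrix_pow A n)"
  have "ln (?w n) / n - ln (?w 1) / n \<le> 1 / real n * ln (real (?N n))" if n: "n > 0" for n
  proof -
    obtain m where m: "n = Suc m" using n gr0_conv_Suc by blast
    have "ln (?w n) \<le> ln (?w m) + ln (?w 1)"
      using ln_entry_sum_add_le[OF matrix, of m 1] m by simp
    also have "?w m \<le> real (?N n)"
      unfolding card_words[OF matrix, symmetric] m
      using separating_cover_number_ge[OF assms cover small, where n = m] by simp
    then have "ln (?w m) \<le> ln (real (?N n))"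
      using entry_sum_ge_1[OF matrix, of m] by simp
    finally have "ln (?w n) - ln (?w 1) \<le> ln (real (?N n))" by simp
    then have "1 / real n * (ln (?w n) - ln (?w 1)) \<le> 1 / real n * ln (real (?N n))"
      by (intro mult_left_mono) auto
    then show ?thesis by (simp add: diff_divide_distrib)
  qed
  then have "limsup (\<lambda>n. ereal (ln (?w n) / n - ln (?w 1) / n)) \<le> limsup (\<lambda>n. ereal (1 / real n * ln (real (?N n))))"
    by (intro Limsup_mono eventually_mono[OF eventually_gt_at_top[of 0]]) simp
  moreover have "limsup (\<lambda>n. ereal (ln (?w n) / n - ln (?w 1) / n)) = ereal (ln (growth_rate A))"
  proof (rule lim_imp_Limsup)
    have "(\<lambda>n. ln (?w n) / n - ln (?w 1) / n) \<longlonglongrightarrow> ln (growth_rate A) - 0"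
      by (intro tendsto_diff ln_entry_sum_tendsto matrix lim_const_over_n)
    then show "(\<lambda>n. ereal (ln (?w n) / n - ln (?w 1) / n)) \<longlonglongrightarrow> ereal (ln (growth_rate A))"
      by simp
  qed simp
  moreover have "limsup (\<lambda>n. ereal (1 / real n * ln (real (?N n)))) \<le> topological_entropy f (limit_set 0)"
    unfolding topological_entropy_def using cover by (intro SUP_upper CollectI)
  ultimately show ?thesis by simp
qed

lemma entropy_eq:
  assumes "compact (UNIV :: 'a set)"
  shows "topological_entropy f (limit_set 0) = ereal (ln (growth_rate A))"
proof (rule antisym)
  show "topological_entropy f (limit_set 0) \<le> ereal (ln (growth_rate A))"
    unfolding topological_entropy_def using entropy_le[OF assms] by (intro SUP_least) blast
qed (rule entropy_ge[OF assms])

end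

section \<open>Uniform constants and the deduction of the theorem\<close>

theorem theorem3p7:
  fixes f :: "nat \<Rightarrow> 'a::metric_space \<Rightarrow> 'a"
    and A :: "real^'n^'n"
    and V :: "'n \<Rightarrow> 'a set"
    and W :: "'n \<Rightarrow> nat \<Rightarrow> 'a set"
    and c :: real
  assumes "transition_matrix A"
    and "\<And>i. V i \<noteq> {}"
    and "\<And>i. bounded (V i)"
    and "\<And>i j. i \<noteq> j \<Longrightarrow> setdist (V i) (V j) > 0"
    and "\<And>i n. W i n \<noteq> {}"
    and "\<And>i n. compact (W i n)"
    and "\<And>i n. W i n \<subseteq> V i"
    and "equi_continuous_in dist dist (\<lambda>_. \<Union>n. \<Union>i. W i n) f"
    and "weakly_coupled_expanding A f W"
    and "c > 1"
    and "\<And>i n x y. x \<in> W i n \<Longrightarrow> y \<in> W i n \<Longrightarrow> dist (f n x) (f n y) \<ge> c * dist x y"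
  shows "(\<exists>L :: nat \<Rightarrow> 'a set.
            (\<forall>n. L n \<noteq> {} \<and> compact (L n) \<and> L n \<subseteq> (\<Union>i. W i n) \<and> f n ` L n = L (Suc n)) \<and>
            equi_conjugate_to_shift f L A \<and>
            (compact (UNIV :: 'a set) \<longrightarrow>
               topological_entropy f (L 0) = ereal (ln (growth_rate A)))) \<and>
         (irreducible_matrix A \<and> (\<exists>i0. (\<Sum>j\<in>UNIV. A $ i0 $ j) \<ge> 2) \<longrightarrow>
            (\<exists>\<delta>>0. li_yorke_chaotic f \<delta>) \<and>
            strongly_li_yorke_chaotic f \<and>
            distributionally_chaotic f)"
proof -
  define D where "D = Max (range (\<lambda>i. diameter (V i)))"
  \<comment> \<open>The inserted \<open>1\<close> makes this visibly a minimum of a nonempty finite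
    set of positive numbers.\<close>
  define \<eta> where "\<eta> = Min (insert 1 ((\<lambda>(i, j). setdist (V i) (V j)) ` {(i, j). i \<noteq> j}))"
  interpret expanding_coding f A W c D \<eta>
  proof
    show "A $ i $ j = 1 \<Longrightarrow> W j (Suc n) \<subseteq> f n ` W i n" for i j n
      using assms(9) unfolding weakly_coupled_expanding_def by blast
    show "dist x y \<le> D" if "x \<in> W i n" "y \<in> W i n" for x y i n
    proof -
      have "dist x y \<le> diameter (V i)"
        using assms(7)[of i n] that by (intro diameter_bounded_bound assms(3)) auto
      also have "\<dots> \<le> D" unfolding D_def by (rule Max_ge) auto
      finally show ?thesis .
    qed
    show "\<eta> > 0" unfolding \<eta>_def using assms(4) by auto
    show "\<eta> \<le> dist x y" if "i \<noteq> j" "x \<in> W i n" "y \<in> W j n" for i j x y n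
    proof -
      have "\<eta> \<le> setdist (V i) (V j)" unfolding \<eta>_def using that(1) by (intro Min_le) auto
      also have "\<dots> \<le> dist x y" using assms(7)[of i n] assms(7)[of j n] that by (intro setdist_le_dist) auto
      finally show ?thesis .
    qed
  qed (use assms in auto)
  have "bounded (\<Union>n. W i n)" for i
    by (rule bounded_subset[OF assms(3)[of i]]) (use assms(7) in blast)
  then have "(\<exists>\<delta>>0. li_yorke_chaotic f \<delta>) \<and> strongly_li_yorke_chaotic f \<and> distributionally_chaotic f"
    if "irreducible_matrix A" "(\<Sum>j\<in>UNIV. A $ i0 $ j) \<ge> 2" for i0
    using chaos[OF that] by blast
  then show ?thesis
    using limit_set_nonempty compact_limit_set limit_set_subset f_limit_set equi_conjugate_limit_set
      entropy_eq
    by (intro conjI exI[of _ limit_set] allI impI) blast+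
qed

end
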